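(* Let $\gamma$ and $\phi$ be given with admissible parameters, i.e. $\gamma$, $b_1$, $c$, $m$ satisfy the assumptions in the context and $\phi$ is built from $(b_1,c,m)$. Then there exist an increasing sequence of positive constants $\{\beta_k\}_{k\ge1}$ tending to infinity and, for each $k\ge1$, a sequence $\{g_{k,i}:i\ge0\}$ of probability generating functions, such that condition (A) (stated in the context) is satisfied.
   Context: **Integral conventions.** For $t\ge r\ge 0$: $\int_r^t=\int_{(r,t]}$, $\int_r^{t-}=\int_{(r,t)}$, $\int_r^\infty=\int_{(r,\infty)}$. For a function $f$, $f(s-)$ is its left limit and $\Delta f(s)=f(s)-f(s-)$. **Continuous data (admissible parameters).** $\gamma:[0,\infty)\to[0,\infty)$ is an increasing (nondecreasing) càdlàg function with $\gamma(0)=0$, identified with the induced measure $\gamma(\mathrm{d}s)$. $b_1,c$ are bounded Borel functions on $[0,\infty)$ and $(1\wedge z^2)m(s,\mathrm{d}z)$ is a bounded kernel from $[0,\infty)$ to $(0,\infty)$. Assume: (1') $c$ is non-negative and $c(s)\gamma(\{s\})=0$ for $s>0$; (2') for every $s>0$, $\big[b_1(s)+\int_0^1 z\,m(s,\mathrm{d}z)\big]\gamma(\{s\})\le 1$ (with $0\cdot\infty=0$); (3') for every $s>0$, $m(s,(1,\infty))\gamma(\{s\})>0$ whenever $b_1(s)\gamma(\{s\})=1$. Put $K_1(\lambda,z)=e^{-\lambda z}-1+\lambda z\mathbf 1_{\{z\le1\}}$ and $$\phi(s,\lambda)=b_1(s)\lambda+c(s)\lambda^2+\int_0^\infty K_1(\lambda,z)\,m(s,\mathrm{d}z).$$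 **Discrete notation.** Probability generating functions are those of distributions on $\{0,1,2,\dots\}$. Given $\{g_{k,n}\}$ and $\{\beta_k\}$, put $g_{k,m,n}=g_{k,m}\circ g_{k,m+1}\circ\cdots\circ g_{k,n-1}$ for $n\ge m+1$, $g_{k,m,m}(z)=z$, and $\gamma_k(t)=\lfloor\beta_k\gamma(t)\rfloor$. **Condition (A).** Let $\gamma_k^{-1}(i)=\inf\{s\ge0:\gamma_k(s)\ge i\}$ and $J_k(r,t)=\{s\in(r,t]:\Delta\gamma_k(s)\ge1\}$. For $s\in J_k(r,t)$ let $$I_{k,s,1}(\lambda)=k\big[g_{k,\gamma_k(s-)}(1-\lambda/k)-(1-\lambda/k)\big]-\int_{\gamma_k^{-1}(\gamma_k(s-))}^{s-}\phi(u,\lambda)\,\gamma(\mathrm{d}u),$$ $$I_{k,s,2}(\lambda)=k\big[g_{k,\gamma_k(s-)+1,\gamma_k(s)}(1-\lambda/k)-(1-\lambda/k)\big]-\phi(s,\lambda)\gamma(\{s\}),$$ $$I_{k,s}(\lambda)=|I_{k,s,1}(\lambda)|+|I_{k,s,2}(\lambda)|.$$ Condition (A): for every $M>0$ there exists a sequence of non-negative càdlàg increasing functions $\{F_k(s):s\ge0\}_{k\ge1}$ such that $\lim_{k\to\infty}F_k(s)=0$ for every $s\ge0$ and, for each $T\ge0$ and an arbitrary sequence of functions $\lambda_k:[0,T]\to[0,M]$, $$\sum_{s\in J_k(r,t)}I_{k,s}(\lambda_k(s))\le F_k(t)-F_k(r),\qquad 0\le r\le t\le T,\ k\ge M.$$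 *)

theory Defs
  imports "HOL-Probability.Probability"
begin

section \<open>Functions on the half line and the induced measure\<close>

text \<open>Functions on $[0,\infty)$ are total functions on the reals; every notion below only
  looks at their values on $[0,\infty)$.\<close>

definition left_lim :: "(real \<Rightarrow> 'a::t2_space) \<Rightarrow> real \<Rightarrow> 'a" where
  "left_lim f s = Lim (at_left s) f"

definition jump :: "(real \<Rightarrow> real) \<Rightarrow> real \<Rightarrow> real" where
  "jump f s = f s - left_lim f s"

definition cadlag :: "(real \<Rightarrow> real) \<Rightarrow> bool" where
  "cadlag f \<longleftrightarrow> (\<forall>s\<ge>0. (f \<longlongrightarrow> f s) (at_right s)) \<and> (\<forall>s>0. \<exists>l. (f \<longlongrightarrow> l) (at_left s))"

text \<open>The function is extended by its value at 0 to the negative half line, so that the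
  measure does not charge $(-\infty,0]$.\<close>

definition induced_measure :: "(real \<Rightarrow> real) \<Rightarrow> real measure" where
  "induced_measure \<gamma> = interval_measure (\<lambda>s. \<gamma> (max 0 s))"

section \<open>Admissible parameters\<close>

definition bounded_kernel :: "'a measure \<Rightarrow> 'b measure \<Rightarrow> ('a \<Rightarrow> 'b measure) \<Rightarrow> bool" where
  "bounded_kernel M N \<kappa> \<longleftrightarrow>
     (\<forall>x\<in>space M. sets (\<kappa> x) = sets N) \<and>
     (\<forall>B\<in>sets N. (\<lambda>x. emeasure (\<kappa> x) B) \<in> borel_measurable M) \<and>
     (\<exists>K::real. \<forall>x\<in>space M. emeasure (\<kappa> x) (space N) \<le> ennreal K)"

text \<open>For each \<open>s \<ge> 0\<close> the measure \<open>m s\<close> lives on the Borel space $(0,\infty)$, so integrals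
  with respect to \<open>m s\<close> are integrals over $(0,\infty)$. In the bound by 1 below, $b_1(s)$
  may be negative and the integral infinite; the type \<open>ereal\<close> provides $0\cdot\infty=0$.\<close>

definition admissible ::
  "(real \<Rightarrow> real) \<Rightarrow> (real \<Rightarrow> real) \<Rightarrow> (real \<Rightarrow> real) \<Rightarrow> (real \<Rightarrow> real measure) \<Rightarrow> bool" where
  "admissible \<gamma> b1 c m \<longleftrightarrow>
     (\<forall>s\<ge>0. 0 \<le> \<gamma> s) \<and> mono_on {0..} \<gamma> \<and> cadlag \<gamma> \<and> \<gamma> 0 = 0 \<and>
     b1 \<in> borel_measurable (restrict_space borel {0..}) \<and> bounded (b1 ` {0..}) \<and>
     c \<in> borel_measurable (restrict_space borel {0..}) \<and> bounded (c ` {0..}) \<and>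
     (\<forall>s\<ge>0. sets (m s) = sets (restrict_space borel {0<..})) \<and>
     bounded_kernel (restrict_space borel {0..}) (restrict_space borel {0<..})
       (\<lambda>s. density (m s) (\<lambda>z. ennreal (min 1 (z\<^sup>2)))) \<and>
     (\<forall>s\<ge>0. 0 \<le> c s) \<and>
     (\<forall>s>0. c s * measure (induced_measure \<gamma>) {s} = 0) \<and>
     (\<forall>s>0. (ereal (b1 s) + enn2ereal (\<integral>\<^sup>+z\<in>{0<..1}. ennreal z \<partial>m s))
              * ereal (measure (induced_measure \<gamma>) {s}) \<le> 1) \<and>
     (\<forall>s>0. b1 s * measure (induced_measure \<gamma>) {s} = 1 \<longrightarrow>
              emeasure (m s) {1<..} * emeasure (induced_measure \<gamma>) {s} > 0)"

definition K1 :: "real \<Rightarrow> real \<Rightarrow> real" where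
  "K1 \<theta> z = exp (- \<theta> * z) - 1 + \<theta> * z * indicator {..1} z"

definition phi ::
  "(real \<Rightarrow> real) \<Rightarrow> (real \<Rightarrow> real) \<Rightarrow> (real \<Rightarrow> real measure) \<Rightarrow> real \<Rightarrow> real \<Rightarrow> real" where
  "phi b1 c m s \<theta> = b1 s * \<theta> + c s * \<theta>\<^sup>2 + (LINT z|m s. K1 \<theta> z)"

section \<open>Probability generating functions and the discrete notation\<close>

definition is_pgf :: "(real \<Rightarrow> real) \<Rightarrow> bool" where
  "is_pgf g \<longleftrightarrow> (\<exists>p :: nat pmf. \<forall>z\<in>{0..1}. g z = (\<Sum>j. pmf p j * z ^ j))"

text \<open>The composition of \<open>g m, g (m + 1), \<dots>, g (n - 1)\<close>, with \<open>g m\<close> outermost.\<close>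

definition comp_range :: "(nat \<Rightarrow> 'a \<Rightarrow> 'a) \<Rightarrow> nat \<Rightarrow> nat \<Rightarrow> 'a \<Rightarrow> 'a" where
  "comp_range g m n = foldr (\<circ>) (map g [m..<n]) id"

definition gamma_k :: "(real \<Rightarrow> real) \<Rightarrow> (nat \<Rightarrow> real) \<Rightarrow> nat \<Rightarrow> real \<Rightarrow> nat" where
  "gamma_k \<gamma> \<beta> k t = nat \<lfloor>\<beta> k * \<gamma> t\<rfloor>"

definition gamma_k_inv :: "(real \<Rightarrow> real) \<Rightarrow> (nat \<Rightarrow> real) \<Rightarrow> nat \<Rightarrow> nat \<Rightarrow> real" where
  "gamma_k_inv \<gamma> \<beta> k i = Inf {s. 0 \<le> s \<and> i \<le> gamma_k \<gamma> \<beta> k s}"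

definition J_k :: "(real \<Rightarrow> real) \<Rightarrow> (nat \<Rightarrow> real) \<Rightarrow> nat \<Rightarrow> real \<Rightarrow> real \<Rightarrow> real set" where
  "J_k \<gamma> \<beta> k r t = {s \<in> {r<..t}. jump (\<lambda>u. real (gamma_k \<gamma> \<beta> k u)) s \<ge> 1}"

section \<open>Condition (A)\<close>

text \<open>The variable \<open>\<theta>\<close> plays the role of $\lambda$ (a reserved symbol), here and above.
  Below \<open>\<phi>\<close> is an arbitrary function of time and \<open>\<theta>\<close>, and \<open>left_lim (gamma_k \<gamma> \<beta> k) s\<close>
  is the left limit in the discrete space of natural numbers.\<close>

definition I_ks1 ::
  "(real \<Rightarrow> real) \<Rightarrow> (real \<Rightarrow> real \<Rightarrow> real) \<Rightarrow> (nat \<Rightarrow> real) \<Rightarrow> (nat \<Rightarrow> nat \<Rightarrow> real \<Rightarrow> real)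
     \<Rightarrow> nat \<Rightarrow> real \<Rightarrow> real \<Rightarrow> real" where
  "I_ks1 \<gamma> \<phi> \<beta> g k s \<theta> =
     (let i = left_lim (gamma_k \<gamma> \<beta> k) s in
        real k * (g k i (1 - \<theta> / real k) - (1 - \<theta> / real k))
        - (LINT u:{gamma_k_inv \<gamma> \<beta> k i<..<s}|induced_measure \<gamma>. \<phi> u \<theta>))"

definition I_ks2 ::
  "(real \<Rightarrow> real) \<Rightarrow> (real \<Rightarrow> real \<Rightarrow> real) \<Rightarrow> (nat \<Rightarrow> real) \<Rightarrow> (nat \<Rightarrow> nat \<Rightarrow> real \<Rightarrow> real)
     \<Rightarrow> nat \<Rightarrow> real \<Rightarrow> real \<Rightarrow> real" where
  "I_ks2 \<gamma> \<phi> \<beta> g k s \<theta> =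
     real k * (comp_range (g k) (left_lim (gamma_k \<gamma> \<beta> k) s + 1) (gamma_k \<gamma> \<beta> k s) (1 - \<theta> / real k)
               - (1 - \<theta> / real k))
     - \<phi> s \<theta> * measure (induced_measure \<gamma>) {s}"

definition I_ks ::
  "(real \<Rightarrow> real) \<Rightarrow> (real \<Rightarrow> real \<Rightarrow> real) \<Rightarrow> (nat \<Rightarrow> real) \<Rightarrow> (nat \<Rightarrow> nat \<Rightarrow> real \<Rightarrow> real)
     \<Rightarrow> nat \<Rightarrow> real \<Rightarrow> real \<Rightarrow> real" where
  "I_ks \<gamma> \<phi> \<beta> g k s \<theta> = \<bar>I_ks1 \<gamma> \<phi> \<beta> g k s \<theta>\<bar> + \<bar>I_ks2 \<gamma> \<phi> \<beta> g k s \<theta>\<bar>"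

text \<open>All sequences are indexed by \<open>k \<ge> 1\<close>. The set \<open>J_k \<gamma> \<beta> k r t\<close> is finite when \<open>\<gamma>\<close> is
  nondecreasing and \<open>\<beta> k \<ge> 0\<close>, so the sum is a genuine one.\<close>

definition condition_A ::
  "(real \<Rightarrow> real) \<Rightarrow> (real \<Rightarrow> real \<Rightarrow> real) \<Rightarrow> (nat \<Rightarrow> real) \<Rightarrow> (nat \<Rightarrow> nat \<Rightarrow> real \<Rightarrow> real) \<Rightarrow> bool"
  where
  "condition_A \<gamma> \<phi> \<beta> g \<longleftrightarrow>
     (\<forall>M>0. \<exists>F :: nat \<Rightarrow> real \<Rightarrow> real.
        (\<forall>k\<ge>1. (\<forall>s\<ge>0. 0 \<le> F k s) \<and> cadlag (F k) \<and> mono_on {0..} (F k)) \<and>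
        (\<forall>s\<ge>0. (\<lambda>k. F k s) \<longlonglongrightarrow> 0) \<and>
        (\<forall>T\<ge>0. \<forall>lam :: nat \<Rightarrow> real \<Rightarrow> real. (\<forall>k\<ge>1. \<forall>s\<in>{0..T}. lam k s \<in> {0..M}) \<longrightarrow>
           (\<forall>r t k. 0 \<le> r \<longrightarrow> r \<le> t \<longrightarrow> t \<le> T \<longrightarrow> 1 \<le> k \<longrightarrow> M \<le> real k \<longrightarrow>
              (\<Sum>s\<in>J_k \<gamma> \<beta> k r t. I_ks \<gamma> \<phi> \<beta> g k s (lam k s)) \<le> F k t - F k r)))"

end

theory Submission
  imports Defs
begin

text \<open>Write $\mu$ for the measure induced by \<open>\<gamma>\<close>. Condition (A) asks for generating functions of two kinds.
  Between two consecutive jumps of $\gamma_k$, on an interval $(a,s)$ of $\mu$-mass at most $1/\beta_k$, a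
  generating function $g$ is wanted with $k[g(1-\lambda/k)-(1-\lambda/k)]$ close to
  $\int_{(a,s)}\phi(u,\lambda)\mu(du)$; at an atom $s$ the target is $\phi(s,\lambda)\mu(\{s\})$ instead.

  On an interval, put $\lambda=k(1-w)$ and take $g(w)=w+\frac1k\int_{(a,s)}\phi(u,k(1-w))\mu(du)$. As a power
  series in $w$ this has coefficients of the right sign except that a negative drift and the big jumps
  may make the constant term negative, and that the coefficient of $w$ is $1$ minus something of order
  $k\,\mu((a,s))$. The first defect is removed by adding the small quadratic term $(2K/k)\lambda^2$ to
  $\phi$, where $K$ bounds all the data; the second by choosing $\beta_k=12Kk$.
  Such a function is $w$ plus an average of
  perturbations of $w$, each of which belongs to a single time $u$ and, as far as the jumps are concerned, to
  a single jump size $z$. It is therefore enough to treat these explicitly and to know that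
  generating functions are stable under averaging a family of perturbations of a fixed one
  (\<open>is_pgf_perturbation_mixture\<close>). This is carried out in \<open>is_pgf_id_plus_K1\<close>, \<open>is_pgf_local\<close> and
  \<open>is_pgf_interval\<close>. The error is $O(1/(k\beta_k))$ per interval, and there are at most
  $\beta_k\gamma(t)$ intervals up to time $t$.

  At an atom $s$ the mass $\mu(\{s\})$ is not small and the quadratic correction is not affordable. But there
  the quadratic part of $\phi$ vanishes, and the bound
  $[b_1(s)+\int_0^1 z\,m(s,dz)]\mu(\{s\})\le1$ says exactly that
  $\lambda-\phi(s,\lambda)\mu(\{s\})=q\lambda+\mu(\{s\})\int(1-e^{-\lambda z})m(s,dz)$ with $q\ge0$, a Bernstein
  function. Therefore $g(w)=\exp(-[\lambda-\phi(s,\lambda)\mu(\{s\})]/k)$ with $\lambda=k(1-w)$ is a compound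
  Poisson generating function (\<open>is_pgf_atom\<close>), and its error is $O(1/k)$ because $e^{-x}=1-x+O(x^2)$.

  An error of order $1/k$ at each of $O(\beta_k)=O(k)$ atoms need not vanish. Hence this function is used only
  at atoms of mass at least $\delta_k=(k+1)^{-1/2}$, of which there are $O(\sqrt k)$; at smaller atoms the
  identity is used, with an error of order $\mu(\{s\})$. The total mass of the atoms in $(0,t]$ that are
  smaller than $\delta_k$ tends to $0$ (\<open>small_atoms_vanish\<close>). The function $F_k(t)$ of condition (A) is
  the sum over the jump times of $\gamma_k$ in $(0,t]$ of the error bounds just described
  (\<open>F_bound\<close>, \<open>F_tendsto_0\<close>).\<close>

section \<open>Closure properties of probability generating functions\<close>

lemma is_pgfI:
  assumes nn: "\<And>j. 0 \<le> a j" and one: "a sums 1"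
    and g: "\<And>w. w \<in> {0..1} \<Longrightarrow> (\<lambda>j. a j * w ^ j) sums g w"
  shows "is_pgf g"
proof -
  have "(\<Sum>j. ennreal (a j)) = ennreal 1"
    using one nn by (subst suminf_ennreal2) (auto simp: sums_iff)
  then have int: "(\<integral>\<^sup>+ j. ennreal (a j) \<partial>count_space UNIV) = 1"
    by (simp add: nn_integral_count_space_nat)
  define p where "p = embed_pmf a"
  have "pmf p j = a j" for j
    unfolding p_def by (rule pmf_embed_pmf[OF nn int])
  with g show ?thesis unfolding is_pgf_def
    by (intro exI[of _ p]) (auto simp: sums_iff)
qed

lemma pmf_nat_sums_1: "pmf (p :: nat pmf) sums 1"
proof -
  have "pmf p sums (integral\<^sup>L (count_space UNIV) (pmf p))"
    by (rule sums_integral_count_space_nat) (rule integrable_pmf)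
  then show ?thesis by (simp add: integral_pmf)
qed

lemma is_pgfD:
  assumes "is_pgf g"
  obtains a :: "nat \<Rightarrow> real" where "\<And>j. 0 \<le> a j" "a sums 1"
    "\<And>w. w \<in> {0..1} \<Longrightarrow> (\<lambda>j. a j * w ^ j) sums g w"
proof -
  obtain p :: "nat pmf" where p: "\<forall>z\<in>{0..1}. g z = (\<Sum>j. pmf p j * z ^ j)"
    using assms by (auto simp: is_pgf_def)
  show ?thesis
  proof (rule that[of "pmf p"])
    show "pmf p sums 1" by (rule pmf_nat_sums_1)
    fix w :: real assume w: "w \<in> {0..1}"
    have "summable (\<lambda>j. pmf p j * w ^ j)"
      using w by (intro summable_comparison_test'[OF sums_summable[OF pmf_nat_sums_1[of p]], of 0])
        (auto simp: abs_mult power_abs intro!: mult_left_le power_le_one)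
    then show "(\<lambda>j. pmf p j * w ^ j) sums g w"
      using p w by (simp add: summable_sums)
  qed auto
qed

lemma is_pgf_cong: "(\<And>w. w \<in> {0..1} \<Longrightarrow> f w = g w) \<Longrightarrow> is_pgf f \<Longrightarrow> is_pgf g"
  by (auto simp: is_pgf_def)

lemma is_pgf_range:
  assumes "is_pgf g" "w \<in> {0..1}" shows "g w \<in> {0..1}"
proof -
  obtain a where a: "\<And>j. 0 \<le> a j" "a sums 1" "(\<lambda>j. a j * w ^ j) sums g w"
    using is_pgfD[OF assms(1)] assms(2) by metis
  have "0 \<le> g w"
    using a(1) assms(2) by (intro sums_le[OF _ sums_zero a(3)]) auto
  moreover have "g w \<le> 1"
    using a(1) assms(2) by (intro sums_le[OF _ a(3,2)]) (auto intro!: mult_left_le power_le_one)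
  ultimately show ?thesis by auto
qed

lemma sums_finite_coeffs:
  fixes f :: "nat \<Rightarrow> real"
  shows "(\<And>j. j \<ge> n \<Longrightarrow> f j = 0) \<Longrightarrow> f sums (\<Sum>j<n. f j)"
  by (rule sums_finite) auto

lemma is_pgf_one: "is_pgf (\<lambda>w. 1)"
proof (rule is_pgfI)
  let ?a = "\<lambda>j::nat. if j = 0 then 1 else (0::real)"
  show "?a sums 1" using sums_finite_coeffs[of 1 ?a] by simp
  show "(\<lambda>j. ?a j * w ^ j) sums 1" for w :: real
    using sums_finite_coeffs[of 1 "\<lambda>j. ?a j * w ^ j"] by simp
qed auto

lemma is_pgf_id: "is_pgf (\<lambda>w. w)"
proof (rule is_pgfI)
  let ?a = "\<lambda>j::nat. if j = 1 then 1 else (0::real)"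
  show "?a sums 1" using sums_finite_coeffs[of 2 ?a] by (simp add: numeral_2_eq_2)
  show "(\<lambda>j. ?a j * w ^ j) sums w" for w :: real
    using sums_finite_coeffs[of 2 "\<lambda>j. ?a j * w ^ j"] by (simp add: numeral_2_eq_2)
qed auto

lemma is_pgf_mult:
  assumes "is_pgf f" "is_pgf g"
  shows "is_pgf (\<lambda>w. f w * g w)"
proof -
  obtain a where a: "\<And>j. 0 \<le> a j" "a sums 1"
    "\<And>w. w \<in> {0..1} \<Longrightarrow> (\<lambda>j. a j * w ^ j) sums f w"
    using is_pgfD[OF assms(1)] by blast
  obtain b where b: "\<And>j. 0 \<le> b j" "b sums 1"
    "\<And>w. w \<in> {0..1} \<Longrightarrow> (\<lambda>j. b j * w ^ j) sums g w"
    using is_pgfD[OF assms(2)] by blast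
  show ?thesis
  proof (rule is_pgfI[where a = "\<lambda>j. \<Sum>i\<le>j. a i * b (j - i)"])
    have prod: "(\<lambda>j. (\<Sum>i\<le>j. a i * b (j - i)) * w ^ j) sums (f w * g w)" if w: "w \<in> {0..1}" for w
    proof -
      have "(\<lambda>j. \<Sum>i\<le>j. (a i * w ^ i) * (b (j - i) * w ^ (j - i)))
              sums ((\<Sum>j. a j * w ^ j) * (\<Sum>j. b j * w ^ j))"
        using a(1) b(1) a(3)[OF w] b(3)[OF w] w
        by (intro Cauchy_product_sums) (auto simp: abs_mult power_abs sums_iff)
      also have "(\<lambda>j. \<Sum>i\<le>j. (a i * w ^ i) * (b (j - i) * w ^ (j - i)))
          = (\<lambda>j. (\<Sum>i\<le>j. a i * b (j - i)) * w ^ j)"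
      proof
        fix j
        have "w ^ i * w ^ (j - i) = w ^ j" if "i \<le> j" for i
          using that by (simp flip: power_add)
        then show "(\<Sum>i\<le>j. (a i * w ^ i) * (b (j - i) * w ^ (j - i))) = (\<Sum>i\<le>j. a i * b (j - i)) * w ^ j"
          unfolding sum_distrib_right by (intro sum.cong) (auto simp: mult_ac)
      qed
      finally show ?thesis using a(3)[OF w] b(3)[OF w] by (simp add: sums_iff)
    qed
    then show "\<And>w. w \<in> {0..1} \<Longrightarrow> (\<lambda>j. (\<Sum>i\<le>j. a i * b (j - i)) * w ^ j) sums (f w * g w)" .
    have "f 1 = 1" "g 1 = 1"
      using a(2) a(3)[of 1] b(2) b(3)[of 1] by (auto simp: sums_iff)
    with prod[of 1] show "(\<lambda>j. \<Sum>i\<le>j. a i * b (j - i)) sums 1" by simp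
  qed (auto intro!: sum_nonneg mult_nonneg_nonneg a(1) b(1))
qed

lemma is_pgf_power: "is_pgf f \<Longrightarrow> is_pgf (\<lambda>w. f w ^ n)"
  by (induction n) (auto intro: is_pgf_one is_pgf_mult)

lemma is_pgf_average3:
  assumes "is_pgf f1" "is_pgf f2" "is_pgf f3"
  shows "is_pgf (\<lambda>w. (f1 w + f2 w + f3 w) / 3)"
proof -
  obtain a1 where a1: "\<And>j. 0 \<le> a1 j" "a1 sums 1"
    "\<And>w. w \<in> {0..1} \<Longrightarrow> (\<lambda>j. a1 j * w ^ j) sums f1 w"
    using is_pgfD[OF assms(1)] by blast
  obtain a2 where a2: "\<And>j. 0 \<le> a2 j" "a2 sums 1"
    "\<And>w. w \<in> {0..1} \<Longrightarrow> (\<lambda>j. a2 j * w ^ j) sums f2 w"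
    using is_pgfD[OF assms(2)] by blast
  obtain a3 where a3: "\<And>j. 0 \<le> a3 j" "a3 sums 1"
    "\<And>w. w \<in> {0..1} \<Longrightarrow> (\<lambda>j. a3 j * w ^ j) sums f3 w"
    using is_pgfD[OF assms(3)] by blast
  show ?thesis
  proof (rule is_pgfI[where a = "\<lambda>j. (a1 j + a2 j + a3 j) / 3"])
    show "(\<lambda>j. (a1 j + a2 j + a3 j) / 3) sums 1"
      using sums_divide[OF sums_add[OF sums_add[OF a1(2) a2(2)] a3(2)], of 3] by simp
    show "(\<lambda>j. (a1 j + a2 j + a3 j) / 3 * w ^ j) sums ((f1 w + f2 w + f3 w) / 3)"
      if "w \<in> {0..1}" for w
      using sums_divide[OF sums_add[OF sums_add[OF a1(3)[OF that] a2(3)[OF that]] a3(3)[OF that]], of 3]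
      by (simp add: add_divide_distrib distrib_right)
  qed (use a1 a2 a3 in auto)
qed

text \<open>The coefficients are recovered one after the other as limits at the points
  $1/(n+2)$ of difference quotients of the series, hence they inherit measurability from its values.\<close>

lemma power_series_coeff_measurable:
  fixes a :: "'x \<Rightarrow> nat \<Rightarrow> real"
  assumes sums: "\<And>x w. x \<in> space N \<Longrightarrow> w \<in> {0..1} \<Longrightarrow> (\<lambda>j. a x j * w ^ j) sums g x w"
    and abs: "\<And>x. x \<in> space N \<Longrightarrow> summable (\<lambda>j. \<bar>a x j\<bar>)"
    and meas: "\<And>w. w \<in> {0..1} \<Longrightarrow> (\<lambda>x. g x w) \<in> borel_measurable N"
  shows "(\<lambda>x. a x j) \<in> borel_measurable N"
proof (induction j rule: less_induct)
  case (less j)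
  define w :: "nat \<Rightarrow> real" where "w n = 1 / real (n + 2)" for n
  have w01: "w n \<in> {0..1}" "0 < w n" "w n < 1" for n by (auto simp: w_def)
  define q where "q n x = (g x (w n) - (\<Sum>i<j. a x i * w n ^ i)) / w n ^ j" for n x
  show ?case
  proof (rule borel_measurable_LIMSEQ_real)
    show "q n \<in> borel_measurable N" for n
      unfolding q_def[abs_def] using less meas[OF w01(1)]
      by (intro borel_measurable_divide borel_measurable_diff borel_measurable_sum
          borel_measurable_times borel_measurable_const) auto
    fix x assume x: "x \<in> space N"
    define h where "h v = (\<Sum>i. a x (i + j) * v ^ i)" for v :: real
    have summ: "summable (\<lambda>i. a x (i + j) * v ^ i)" if "norm v < 1" for v :: real
    proof (rule summable_comparison_test')
      show "summable (\<lambda>i. \<bar>a x (i + j)\<bar>)" using abs[OF x] by (rule summable_ignore_initial_segment)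
      show "norm (a x (i + j) * v ^ i) \<le> \<bar>a x (i + j)\<bar>" for i
        using that by (auto simp: abs_mult power_abs intro!: mult_left_le power_le_one)
    qed
    have "(h \<longlongrightarrow> a x (0 + j)) (at 0)"
      by (rule powser_limit_0[of 1 "\<lambda>i. a x (i + j)"]) (auto simp: h_def intro!: summable_sums summ)
    moreover have "filterlim w (at 0) sequentially"
      unfolding w_def by (rule filterlim_atI) (real_asymp | simp)+
    ultimately have lim: "(\<lambda>n. h (w n)) \<longlonglongrightarrow> a x j"
      by (auto intro: filterlim_compose)
    have "h (w n) = q n x" for n
    proof -
      have "g x (w n) = (\<Sum>i. a x (i + j) * w n ^ (i + j)) + (\<Sum>i<j. a x i * w n ^ i)"
        using sums[OF x w01(1)] suminf_split_initial_segment[of "\<lambda>i. a x i * w n ^ i" j]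
        by (auto simp: sums_iff)
      also have "(\<Sum>i. a x (i + j) * w n ^ (i + j)) = h (w n) * w n ^ j"
        unfolding h_def using w01[of n] by (subst suminf_mult2[OF summ]) (auto simp: power_add mult_ac)
      finally show ?thesis using w01(2)[of n] by (simp add: q_def)
    qed
    with lim show "(\<lambda>n. q n x) \<longlonglongrightarrow> a x j" by simp
  qed
qed

text \<open>A generating function \<open>b\<close> may be perturbed by an average of perturbations that are
  each harmless: the result is the mixture, with weights \<open>\<nu> / r\<close>, of the generating functions
  \<open>b + r * d x\<close>, the missing mass being assigned to \<open>b\<close>. The measure need not be normalised, which
  allows \<open>\<nu>\<close> to be a jump kernel or the restriction of the clock measure to an interval.\<close>

lemma is_pgf_perturbation_mixture:
  fixes \<nu> :: "'x measure"
  assumes "finite_measure \<nu>" and mass: "measure \<nu> (space \<nu>) \<le> r" and r: "0 < r"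
    and base: "is_pgf b"
    and comp: "\<And>x. x \<in> space \<nu> \<Longrightarrow> is_pgf (\<lambda>w. b w + r * d x w)"
    and meas: "\<And>w. w \<in> {0..1} \<Longrightarrow> (\<lambda>x. d x w) \<in> borel_measurable \<nu>"
  shows "is_pgf (\<lambda>w. b w + (LINT x|\<nu>. d x w))"
proof -
  interpret finite_measure \<nu> by fact
  obtain \<beta> where \<beta>: "\<And>j. 0 \<le> \<beta> j" "\<beta> sums 1"
    "\<And>w. w \<in> {0..1} \<Longrightarrow> (\<lambda>j. \<beta> j * w ^ j) sums b w"
    using is_pgfD[OF base] by blast
  have "\<forall>x. \<exists>a. x \<in> space \<nu> \<longrightarrow> (\<forall>j. 0 \<le> a j) \<and> a sums 1 \<and>
      (\<forall>w\<in>{0..1}. (\<lambda>j. a j * w ^ j) sums (b w + r * d x w))"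
  proof (intro allI)
    fix x
    show "\<exists>a. x \<in> space \<nu> \<longrightarrow> (\<forall>j. 0 \<le> a j) \<and> a sums 1 \<and>
        (\<forall>w\<in>{0..1}. (\<lambda>j. a j * w ^ j) sums (b w + r * d x w))"
    proof (cases "x \<in> space \<nu>")
      case True
      from is_pgfD[OF comp[OF True]] show ?thesis by metis
    qed auto
  qed
  then obtain a where a0: "\<And>x. x \<in> space \<nu> \<Longrightarrow> (\<forall>j. 0 \<le> a x j) \<and> a x sums 1 \<and>
      (\<forall>w\<in>{0..1}. (\<lambda>j. a x j * w ^ j) sums (b w + r * d x w))"
    by metis
  then have a: "\<And>x j. x \<in> space \<nu> \<Longrightarrow> 0 \<le> a x j" "\<And>x. x \<in> space \<nu> \<Longrightarrow> a x sums 1"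
    "\<And>x w. x \<in> space \<nu> \<Longrightarrow> w \<in> {0..1} \<Longrightarrow> (\<lambda>j. a x j * w ^ j) sums (b w + r * d x w)"
    by auto
  have am [measurable]: "(\<lambda>x. a x j) \<in> borel_measurable \<nu>" for j
    by (rule power_series_coeff_measurable[where g = "\<lambda>x w. b w + r * d x w"])
      (use a meas in \<open>auto simp: sums_iff intro!: borel_measurable_add borel_measurable_times\<close>)
  have a1: "a x j \<le> 1" if "x \<in> space \<nu>" for x j
  proof -
    have "(\<Sum>i\<in>{j}. a x i) \<le> (\<Sum>i. a x i)"
      using a[OF that] by (intro sum_le_suminf) (auto simp: sums_iff)
    with a(2)[OF that] show ?thesis by (auto simp: sums_iff)
  qed
  have int [simp]: "integrable \<nu> (\<lambda>x. a x j)" for j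
    by (rule integrable_const_bound[of _ 1]) (use a a1 in auto)
  define \<tau> where "\<tau> = measure \<nu> (space \<nu>)"
  define A where "A j = (LINT x|\<nu>. a x j)" for j
  have A0: "0 \<le> A j" for j
    unfolding A_def using a(1) by (intro integral_nonneg_AE) auto
  \<comment> \<open>The averaged coefficients are summable, which justifies exchanging sum and integral.\<close>
  have part: "(\<Sum>j<n. A j) \<le> \<tau>" for n
  proof -
    have "(\<Sum>j<n. A j) = (LINT x|\<nu>. (\<Sum>j<n. a x j))"
      unfolding A_def by simp
    also have "\<dots> \<le> (LINT x|\<nu>. 1)"
    proof (rule integral_mono)
      fix x assume x: "x \<in> space \<nu>"
      have "(\<Sum>j<n. a x j) \<le> (\<Sum>j. a x j)"
        using a[OF x] by (intro sum_le_suminf) (auto simp: sums_iff)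
      with a(2)[OF x] show "(\<Sum>j<n. a x j) \<le> 1" by (auto simp: sums_iff)
    qed auto
    finally show ?thesis by (simp add: \<tau>_def)
  qed
  have Asumm: "summable A"
    by (rule summableI_nonneg_bounded[OF A0 part])
  have Asums: "(\<lambda>j. A j * w ^ j) sums (LINT x|\<nu>. b w + r * d x w)" if w: "w \<in> {0..1}" for w
  proof -
    have absw: "\<bar>w\<bar> \<le> 1" "0 \<le> w" using w by auto
    have "(\<lambda>j. LINT x|\<nu>. a x j * w ^ j) sums (LINT x|\<nu>. (\<Sum>j. a x j * w ^ j))"
    proof (rule sums_integral)
      show "integrable \<nu> (\<lambda>x. a x j * w ^ j)" for j by simp
      show "AE x in \<nu>. summable (\<lambda>j. norm (a x j * w ^ j))"
        using a w by (intro AE_I2) (auto simp: abs_mult sums_iff)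
      show "summable (\<lambda>j. LINT x|\<nu>. norm (a x j * w ^ j))"
      proof (rule summable_comparison_test'[OF Asumm])
        fix j
        have "(LINT x|\<nu>. norm (a x j * w ^ j)) = (LINT x|\<nu>. a x j * w ^ j)"
          using a w by (intro Bochner_Integration.integral_cong) (auto simp: abs_mult)
        also have "\<dots> = A j * w ^ j" by (simp add: A_def)
        also have "norm \<dots> \<le> A j"
          using A0 absw by (auto simp: abs_mult power_abs intro!: mult_left_le power_le_one)
        finally show "norm (LINT x|\<nu>. norm (a x j * w ^ j)) \<le> A j" .
      qed
    qed
    also have "(LINT x|\<nu>. (\<Sum>j. a x j * w ^ j)) = (LINT x|\<nu>. b w + r * d x w)"
      using a(3) w by (intro Bochner_Integration.integral_cong) (auto simp: sums_iff)
    finally show ?thesis by (simp add: A_def)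
  qed
  have dint: "integrable \<nu> (\<lambda>x. d x w)" if w: "w \<in> {0..1}" for w
  proof (rule integrable_const_bound[of _ "2 / r"])
    show "AE x in \<nu>. norm (d x w) \<le> 2 / r"
    proof (rule AE_I2)
      fix x assume x: "x \<in> space \<nu>"
      have "b w \<in> {0..1}" "b w + r * d x w \<in> {0..1}"
        using is_pgf_range[OF base w] is_pgf_range[OF comp[OF x] w] by auto
      then have "\<bar>r * d x w\<bar> \<le> 2" by auto
      then show "norm (d x w) \<le> 2 / r" using r by (simp add: abs_mult field_simps)
    qed
  qed (rule meas[OF w])
  have comb: "(\<lambda>j. ((1 - \<tau> / r) * \<beta> j + A j / r) * w ^ j) sums (b w + (LINT x|\<nu>. d x w))"
    if w: "w \<in> {0..1}" for w
  proof -
    have "(LINT x|\<nu>. b w + r * d x w) = \<tau> * b w + r * (LINT x|\<nu>. d x w)"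
      using dint[OF w] by (simp add: \<tau>_def)
    then have "(1 - \<tau> / r) * b w + (LINT x|\<nu>. b w + r * d x w) / r = b w + (LINT x|\<nu>. d x w)"
      using r by (simp add: field_simps)
    with sums_add[OF sums_mult[OF \<beta>(3)[OF w], of "1 - \<tau> / r"] sums_divide[OF Asums[OF w], of r]]
    show ?thesis by (simp add: algebra_simps)
  qed
  have at1: "b 1 + (LINT x|\<nu>. d x 1) = 1"
  proof -
    have b1: "b 1 = 1" using \<beta>(2) \<beta>(3)[of 1] by (auto simp: sums_iff)
    have "d x 1 = 0" if "x \<in> space \<nu>" for x
      using a(2)[OF that] a(3)[OF that, of 1] b1 r by (auto simp: sums_iff)
    then have "(LINT x|\<nu>. d x 1) = (LINT x|\<nu>. 0)"
      by (intro Bochner_Integration.integral_cong) auto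
    with b1 show ?thesis by simp
  qed
  show ?thesis
  proof (rule is_pgfI[where a = "\<lambda>j. (1 - \<tau> / r) * \<beta> j + A j / r"])
    show "0 \<le> (1 - \<tau> / r) * \<beta> j + A j / r" for j
      using A0 \<beta>(1) r mass by (intro add_nonneg_nonneg mult_nonneg_nonneg) (auto simp: \<tau>_def)
    show "(\<lambda>j. (1 - \<tau> / r) * \<beta> j + A j / r) sums 1"
      using comb[of 1] at1 by simp
  qed (rule comb)
qed

text \<open>A Poisson number of independent summands with generating function \<open>f\<close>, obtained as
  a mixture of the powers of \<open>f\<close>.\<close>

lemma is_pgf_compound_poisson:
  assumes f: "is_pgf f" and "0 \<le> R"
  shows "is_pgf (\<lambda>w. exp (- (R * (1 - f w))))"
proof (cases "R = 0")
  case True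
  then show ?thesis by (simp add: is_pgf_one)
next
  case False
  with \<open>0 \<le> R\<close> have R: "0 < R" by simp
  have "is_pgf (\<lambda>w. w + (LINT n|measure_pmf (poisson_pmf R). f w ^ n - w))"
    by (rule is_pgf_perturbation_mixture[where r = 1])
      (auto simp: is_pgf_id is_pgf_power[OF f] measure_pmf.finite_measure_axioms)
  then show ?thesis
  proof (rule is_pgf_cong[rotated])
    fix w :: real assume w: "w \<in> {0..1}"
    have fw: "f w \<in> {0..1}" by (rule is_pgf_range[OF f w])
    have E: "measure_pmf (poisson_pmf R) = density (count_space UNIV) (\<lambda>n. ennreal (pmf (poisson_pmf R) n))"
      by (rule measure_pmf_eq_density)
    have int: "integrable (measure_pmf (poisson_pmf R)) (\<lambda>n. f w ^ n)"
      using fw by (intro measure_pmf.integrable_const_bound[of _ 1]) (auto intro!: power_le_one)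
    then have "integrable (count_space UNIV) (\<lambda>n. pmf (poisson_pmf R) n * f w ^ n)"
      unfolding E by (subst (asm) integrable_density) auto
    then have "(\<lambda>n. pmf (poisson_pmf R) n * f w ^ n)
        sums (integral\<^sup>L (count_space UNIV) (\<lambda>n. pmf (poisson_pmf R) n * f w ^ n))"
      by (rule sums_integral_count_space_nat)
    moreover have "integral\<^sup>L (count_space UNIV) (\<lambda>n. pmf (poisson_pmf R) n * f w ^ n)
        = (LINT n|measure_pmf (poisson_pmf R). f w ^ n)"
      unfolding E by (subst integral_density) auto
    moreover have "(\<lambda>n. pmf (poisson_pmf R) n * f w ^ n) sums (exp (R * f w) * exp (- R))"
    proof -
      have "(\<lambda>n. exp (- R) * ((R * f w) ^ n /\<^sub>R fact n)) sums (exp (-R) * exp (R * f w))"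
        by (intro sums_mult exp_converges)
      then show ?thesis using R by (simp add: pmf_poisson[OF R] power_mult_distrib divide_inverse mult_ac)
    qed
    ultimately have "(LINT n|measure_pmf (poisson_pmf R). f w ^ n) = exp (R * f w) * exp (- R)"
      by (metis sums_unique2)
    then show "w + (LINT n|measure_pmf (poisson_pmf R). f w ^ n - w) = exp (- (R * (1 - f w)))"
      using int by (simp add: exp_add[symmetric] algebra_simps)
  qed
qed

section \<open>Explicit generating functions\<close>

text \<open>The Poisson term contributes positive coefficients of every order, so the polynomial
  may have negative coefficients of order 0 and 1, up to what the Poisson term compensates.\<close>

lemma is_pgf_quadratic_plus_poisson:
  assumes "0 \<le> \<eta>" "0 \<le> x"
    and "0 \<le> p0 + \<eta> * exp (- x)" "0 \<le> p1 + \<eta> * (x * exp (- x))" "0 \<le> p2"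
    and total: "p0 + p1 + p2 + \<eta> = 1"
  shows "is_pgf (\<lambda>w. p0 + p1 * w + p2 * w\<^sup>2 + \<eta> * exp (- (x * (1 - w))))"
proof -
  define q :: "nat \<Rightarrow> real" where
    "q j = (if j = 0 then p0 else if j = 1 then p1 else if j = 2 then p2 else 0)" for j
  define a where "a j = q j + \<eta> * (exp (- x) * (x ^ j / fact j))" for j
  have sums: "(\<lambda>j. a j * w ^ j) sums (p0 + p1 * w + p2 * w\<^sup>2 + \<eta> * exp (- (x * (1 - w))))" for w
  proof -
    have "(\<lambda>j. q j * w ^ j) sums (p0 + p1 * w + p2 * w\<^sup>2)"
      using sums_finite_coeffs[of 3 "\<lambda>j. q j * w ^ j"] by (simp add: q_def numeral_3_eq_3 power2_eq_square)
    moreover have "(\<lambda>j. \<eta> * exp (- x) * ((x * w) ^ j /\<^sub>R fact j)) sums (\<eta> * exp (- x) * exp (x * w))"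
      by (intro sums_mult exp_converges)
    ultimately have "(\<lambda>j. q j * w ^ j + \<eta> * exp (- x) * ((x * w) ^ j /\<^sub>R fact j))
        sums (p0 + p1 * w + p2 * w\<^sup>2 + \<eta> * exp (- x) * exp (x * w))"
      by (rule sums_add)
    moreover have "q j * w ^ j + \<eta> * exp (- x) * ((x * w) ^ j /\<^sub>R fact j) = a j * w ^ j" for j
      by (simp add: a_def power_mult_distrib divide_inverse algebra_simps)
    moreover have "exp (- x) * exp (x * w) = exp (- (x * (1 - w)))"
      by (simp add: exp_add[symmetric] algebra_simps)
    ultimately show ?thesis by (simp add: mult.assoc)
  qed
  show ?thesis
  proof (rule is_pgfI[of a])
    show "0 \<le> a j" for j
      using assms by (cases "j = 0 \<or> j = 1") (auto simp: a_def q_def mult_ac intro!: add_nonneg_nonneg)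
    show "a sums 1" using sums[of 1] total by simp
  qed (rule sums)
qed

lemma is_pgf_quadratic:
  assumes "0 \<le> p0" "0 \<le> p1" "0 \<le> p2" "p0 + p1 + p2 = 1"
  shows "is_pgf (\<lambda>w. p0 + p1 * w + p2 * w\<^sup>2)"
  using is_pgf_quadratic_plus_poisson[of 0 0 p0 p1 p2] assms by simp

text \<open>The contribution of a single jump size in the atom construction; the last assumption is the sign of the
  constant coefficient, the others being multiples of Poisson weights.\<close>

lemma is_pgf_one_minus_poisson:
  assumes "0 \<le> \<epsilon>" "0 \<le> x" "\<epsilon> * (1 - exp (- x)) \<le> 1"
  shows "is_pgf (\<lambda>w. 1 - \<epsilon> * (1 - exp (- (x * (1 - w)))))"
proof -
  have "is_pgf (\<lambda>w. (1 - \<epsilon>) + 0 * w + 0 * w\<^sup>2 + \<epsilon> * exp (- (x * (1 - w))))"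
    using assms by (intro is_pgf_quadratic_plus_poisson) (auto simp: algebra_simps)
  then show ?thesis by (simp add: algebra_simps)
qed

text \<open>One jump size \<open>z\<close> in the interval construction. For \<open>z > 1\<close> the kernel is negative at \<open>w = 0\<close>,
  which the square compensates; for \<open>z \<le> 1\<close> the compensator makes the coefficient of \<open>w\<close> at worst
  $-k^2z^2$, which after division by $z^2$ is bounded uniformly in \<open>z\<close>.\<close>

lemma is_pgf_id_plus_K1:
  assumes k: "1 \<le> k" and z: "0 < z" and e: "0 \<le> \<epsilon>" "\<epsilon> * (k\<^sup>2 + 2) \<le> 1"
  shows "is_pgf (\<lambda>w. w + \<epsilon> * (K1 (k * (1 - w)) z / min 1 (z\<^sup>2) + (1 - w)\<^sup>2))"
proof -
  define x where "x = k * z"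
  define \<rho> where "\<rho> = min 1 (z\<^sup>2)"
  define I :: real where "I = indicator {..1} z"
  define \<eta> where "\<eta> = \<epsilon> / \<rho>"
  have \<rho>: "0 < \<rho>" using z by (simp add: \<rho>_def)
  have \<eta>: "0 \<le> \<eta>" using \<rho> e by (simp add: \<eta>_def)
  have x: "0 < x" using k z by (simp add: x_def)
  have ex: "1 - x \<le> exp (- x)" using exp_ge_add_one_self[of "- x"] by simp
  have e2: "\<epsilon> * k\<^sup>2 + 2 * \<epsilon> \<le> 1" "2 * \<epsilon> \<le> 1"
  proof -
    show "\<epsilon> * k\<^sup>2 + 2 * \<epsilon> \<le> 1" using e by (simp add: algebra_simps)
    moreover have "0 \<le> \<epsilon> * k\<^sup>2" using e by simp
    ultimately show "2 * \<epsilon> \<le> 1" by linarith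
  qed
  have "is_pgf (\<lambda>w. (\<eta> * (x * I - 1) + \<epsilon>) + (1 - \<eta> * x * I - 2 * \<epsilon>) * w + \<epsilon> * w\<^sup>2
      + \<eta> * exp (- (x * (1 - w))))"
  proof (rule is_pgf_quadratic_plus_poisson)
    show "0 \<le> \<eta> * (x * I - 1) + \<epsilon> + \<eta> * exp (- x)"
    proof (cases "z \<le> 1")
      case True
      then have "0 \<le> \<eta> * (x - 1 + exp (- x))" using ex \<eta> by (intro mult_nonneg_nonneg) auto
      with True e show ?thesis by (simp add: I_def algebra_simps)
    next
      case False
      then have "1 \<le> z\<^sup>2" by (intro one_le_power) auto
      then have "\<eta> = \<epsilon>" by (simp add: \<eta>_def \<rho>_def)
      with False e show ?thesis by (simp add: I_def)
    qed
    show "0 \<le> 1 - \<eta> * x * I - 2 * \<epsilon> + \<eta> * (x * exp (- x))"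
    proof (cases "z \<le> 1")
      case True
      then have \<rho>z: "\<rho> = z\<^sup>2" using z by (simp add: \<rho>_def power_le_one min_absorb2)
      have "\<eta> * (x * (1 - exp (- x))) \<le> \<eta> * (x * x)"
        using ex \<eta> x by (intro mult_left_mono) auto
      also have "\<dots> = \<epsilon> * k\<^sup>2"
        using z by (simp add: \<eta>_def \<rho>z x_def power2_eq_square)
      finally have "\<eta> * x - \<eta> * (x * exp (- x)) \<le> \<epsilon> * k\<^sup>2" by (simp add: algebra_simps)
      with e2(1) True show ?thesis by (simp add: I_def)
    next
      case False
      then show ?thesis using e2 \<eta> x by (simp add: I_def)
    qed
  qed (use \<eta> x e in \<open>auto simp: algebra_simps\<close>)
  then show ?thesis
  proof (rule is_pgf_cong[rotated])
    fix w :: real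
    have "K1 (k * (1 - w)) z = exp (- (x * (1 - w))) - 1 + x * (1 - w) * I"
      by (simp add: K1_def x_def I_def mult_ac)
    then have K: "\<epsilon> * (K1 (k * (1 - w)) z / min 1 (z\<^sup>2)) = \<eta> * (exp (- (x * (1 - w))) - 1 + x * (1 - w) * I)"
      by (simp add: \<eta>_def \<rho>_def)
    show "(\<eta> * (x * I - 1) + \<epsilon>) + (1 - \<eta> * x * I - 2 * \<epsilon>) * w + \<epsilon> * w\<^sup>2 + \<eta> * exp (- (x * (1 - w)))
        = w + \<epsilon> * (K1 (k * (1 - w)) z / min 1 (z\<^sup>2) + (1 - w)\<^sup>2)"
      unfolding distrib_left[of \<epsilon>] K by (simp add: power2_eq_square algebra_simps)
  qed
qed

section \<open>Integer-valued nondecreasing paths\<close>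

text \<open>This is the behaviour of $\gamma_k=\lfloor\beta_k\gamma\rfloor$: for an integer-valued nondecreasing path,
  right continuity means being constant for some time.\<close>

locale step_path =
  fixes N :: "real \<Rightarrow> nat"
  assumes mono: "0 \<le> s \<Longrightarrow> s \<le> t \<Longrightarrow> N s \<le> N t"
    and right_const: "0 \<le> t \<Longrightarrow> \<exists>u>t. N u = N t"
begin

abbreviation pre :: "real \<Rightarrow> nat" where "pre s \<equiv> left_lim N s"

definition jumps :: "real \<Rightarrow> real \<Rightarrow> real set" where
  "jumps r t = {s \<in> {r<..t}. pre s < N s}"

lemma left_const:
  assumes "0 < s"
  obtains u where "0 \<le> u" "u < s" "\<And>v. u \<le> v \<Longrightarrow> v < s \<Longrightarrow> N v = pre s"
    "((\<lambda>v. N v) \<longlongrightarrow> pre s) (at_left s)"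
proof -
  have fin: "finite (N ` {0..<s})"
    by (rule finite_subset[of _ "{..N s}"]) (auto intro: mono)
  have ne: "N ` {0..<s} \<noteq> {}" using assms by auto
  define i where "i = Max (N ` {0..<s})"
  have "i \<in> N ` {0..<s}" unfolding i_def using fin ne by (rule Max_in)
  then obtain u where u: "0 \<le> u" "u < s" "N u = i" by auto
  have i: "N v = i" if "u \<le> v" "v < s" for v
  proof (rule antisym)
    show "N v \<le> i" unfolding i_def using fin that u by (intro Max_ge) auto
    show "i \<le> N v" using mono[of u v] u that by auto
  qed
  have "eventually (\<lambda>v. N v = i) (at_left s)"
    using eventually_at_left_real[OF u(2)] by eventually_elim (auto intro: i)
  then have lim: "(N \<longlongrightarrow> i) (at_left s)" by (rule tendsto_eventually)
  then have "pre s = i" unfolding left_lim_def by (intro tendsto_Lim) auto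
  with u i lim show ?thesis by (intro that) auto
qed

lemma jump_eq:
  assumes "0 < s" shows "jump (\<lambda>u. real (N u)) s = real (N s) - real (pre s)"
proof -
  obtain u where "((\<lambda>v. N v) \<longlongrightarrow> pre s) (at_left s)" "u < s"
    "\<And>v. u \<le> v \<Longrightarrow> v < s \<Longrightarrow> N v = pre s" using left_const[OF assms] by metis
  then have "eventually (\<lambda>v. real (N v) = real (pre s)) (at_left s)"
    by (intro eventually_mono[OF eventually_at_left_real[of u s]]) auto
  then have "((\<lambda>v. real (N v)) \<longlongrightarrow> real (pre s)) (at_left s)" by (rule tendsto_eventually)
  then have "left_lim (\<lambda>v. real (N v)) s = real (pre s)"
    unfolding left_lim_def by (intro tendsto_Lim) auto
  then show ?thesis by (simp add: jump_def)
qed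

lemma jumps_eq: "0 \<le> r \<Longrightarrow> jumps r t = {s \<in> {r<..t}. jump (\<lambda>u. real (N u)) s \<ge> 1}"
  by (auto simp: jumps_def jump_eq)

lemma le_pre:
  assumes "0 \<le> s" "s < s'" shows "N s \<le> pre s'"
proof -
  obtain u where u: "0 \<le> u" "u < s'" "\<And>v. u \<le> v \<Longrightarrow> v < s' \<Longrightarrow> N v = pre s'"
    using left_const[of s'] assms by (metis order.strict_trans1)
  have "N s \<le> N (max u s)" using assms by (intro mono) auto
  also have "\<dots> = pre s'" using u assms by auto
  finally show ?thesis .
qed

lemma jump_pre_strict_mono:
  assumes "s \<in> jumps 0 t" "s < s'" shows "pre s < N s" "N s \<le> pre s'"
  using assms le_pre[of s s'] by (auto simp: jumps_def)

text \<open>The value just before a jump identifies the jump, because it strictly increases from one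
  jump to the next. This bounds the number of jumps by the terminal value.\<close>

lemma inj_on_pre: "inj_on pre (jumps 0 t)"
proof (rule linorder_inj_onI)
  fix s s' assume "s < s'" "s \<in> jumps 0 t" "s' \<in> jumps 0 t"
  then show "pre s \<noteq> pre s'" using jump_pre_strict_mono[of s t s'] by linarith
qed auto

lemma pre_jumps_subset: "pre ` jumps 0 t \<subseteq> {..<N t}"
proof
  fix i assume "i \<in> pre ` jumps 0 t"
  then obtain s where "s \<in> jumps 0 t" "i = pre s" by auto
  then show "i \<in> {..<N t}" using mono[of s t] by (auto simp: jumps_def)
qed

lemma finite_jumps: "0 \<le> r \<Longrightarrow> finite (jumps r t)"
  using inj_on_finite[OF inj_on_pre pre_jumps_subset[of t]]
  by (rule rev_finite_subset) (auto simp: jumps_def)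

lemma card_jumps: "card (jumps 0 t) \<le> N t"
  using card_inj_on_le[OF inj_on_pre pre_jumps_subset[of t]] by simp

lemma jumps_split:
  assumes "0 \<le> r" "r \<le> t"
  shows "jumps 0 t = jumps 0 r \<union> jumps r t" "jumps 0 r \<inter> jumps r t = {}"
  using assms by (auto simp: jumps_def)

lemma sum_jumps_split:
  fixes e :: "real \<Rightarrow> real"
  assumes "0 \<le> r" "r \<le> t"
  shows "sum e (jumps 0 t) - sum e (jumps 0 r) = sum e (jumps r t)"
proof -
  have "sum e (jumps 0 r \<union> jumps r t) = sum e (jumps 0 r) + sum e (jumps r t)"
    using assms by (intro sum.union_disjoint finite_jumps jumps_split(2)) auto
  then show ?thesis using jumps_split(1)[OF assms] by simp
qed

lemma no_jumps:
  assumes "0 \<le> u" "N v = N u" shows "jumps u v = {}"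
proof -
  have "\<not> pre s < N s" if "s \<in> {u<..v}" for s
    using le_pre[of u s] mono[of s v] mono[of u s] that assms by auto
  then show ?thesis by (auto simp: jumps_def)
qed

text \<open>The sum changes only where the path does, so it is locally constant on either side of any time.\<close>

lemma cadlag_sum_jumps:
  fixes e :: "real \<Rightarrow> real"
  shows "cadlag (\<lambda>t. sum e (jumps 0 t))"
  unfolding cadlag_def
proof (intro conjI allI impI)
  have const: "sum e (jumps 0 v) = sum e (jumps 0 u)" if "0 \<le> u" "u \<le> v" "N v = N u" for u v
    using sum_jumps_split[of u v e] no_jumps[of u v] that by simp
  fix s :: real
  {
    assume s: "0 \<le> s"
    obtain u where u: "s < u" "N u = N s" using right_const[OF s] by auto
    have "eventually (\<lambda>v. sum e (jumps 0 v) = sum e (jumps 0 s)) (at_right s)"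
      using eventually_at_right_real[OF u(1)]
    proof eventually_elim
      case (elim v)
      then show ?case using const[of s v] mono[of s v] mono[of v u] u s by auto
    qed
    then show "((\<lambda>t. sum e (jumps 0 t)) \<longlongrightarrow> sum e (jumps 0 s)) (at_right s)"
      by (rule tendsto_eventually)
  }
  {
    assume s: "0 < s"
    obtain u where u: "0 \<le> u" "u < s" "\<And>v. u \<le> v \<Longrightarrow> v < s \<Longrightarrow> N v = pre s"
      using left_const[OF s] by metis
    have "eventually (\<lambda>v. sum e (jumps 0 v) = sum e (jumps 0 u)) (at_left s)"
      using eventually_at_left_real[OF u(2)]
    proof eventually_elim
      case (elim v)
      then show ?case using const[of u v] u(1,2) u(3)[of u] u(3)[of v] by auto
    qed
    then show "\<exists>l. ((\<lambda>t. sum e (jumps 0 t)) \<longlongrightarrow> l) (at_left s)"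
      by (intro exI[of _ "sum e (jumps 0 u)"] tendsto_eventually)
  }
qed

end

section \<open>The measure of a nondecreasing path\<close>

locale increasing_path =
  fixes \<gamma> :: "real \<Rightarrow> real"
  assumes mono: "0 \<le> s \<Longrightarrow> s \<le> t \<Longrightarrow> \<gamma> s \<le> \<gamma> t"
    and right_cont: "0 \<le> t \<Longrightarrow> (\<gamma> \<longlongrightarrow> \<gamma> t) (at_right t)"
    and zero: "\<gamma> 0 = 0"
begin

abbreviation \<mu> :: "real measure" where "\<mu> \<equiv> induced_measure \<gamma>"

lemma nonneg: "0 \<le> t \<Longrightarrow> 0 \<le> \<gamma> t"
  using mono[of 0 t] zero by simp

lemma sets_\<mu> [simp, measurable_cong]: "sets \<mu> = sets borel"
  by (simp add: induced_measure_def)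

lemma space_\<mu> [simp]: "space \<mu> = UNIV"
  using sets_eq_imp_space_eq[OF sets_\<mu>] by simp

lemma emeasure_Ioc:
  assumes "0 \<le> a" "a \<le> b" shows "emeasure \<mu> {a<..b} = ennreal (\<gamma> b - \<gamma> a)"
proof -
  have "((\<lambda>s. \<gamma> (max 0 s)) \<longlongrightarrow> \<gamma> (max 0 x)) (at_right x)" for x
  proof (cases "0 \<le> x")
    case True
    have "eventually (\<lambda>s. \<gamma> s = \<gamma> (max 0 s)) (at_right x)"
      using eventually_at_right_less[of x] by eventually_elim (use True in auto)
    with right_cont[OF True] have "((\<lambda>s. \<gamma> (max 0 s)) \<longlongrightarrow> \<gamma> x) (at_right x)"
      by (rule Lim_transform_eventually)
    with True show ?thesis by simp
  next
    case False
    then have "eventually (\<lambda>s. \<gamma> (max 0 s) = \<gamma> (max 0 x)) (at_right x)"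
      by (intro eventually_mono[OF eventually_at_right_real[of x 0]]) auto
    then show ?thesis by (rule tendsto_eventually)
  qed
  then have "emeasure \<mu> {a<..b} = ennreal (\<gamma> (max 0 b) - \<gamma> (max 0 a))"
    unfolding induced_measure_def using assms
    by (intro emeasure_interval_measure_Ioc) (auto simp: continuous_within intro: mono)
  with assms show ?thesis by simp
qed

lemma measure_Ioc: "0 \<le> a \<Longrightarrow> a \<le> b \<Longrightarrow> measure \<mu> {a<..b} = \<gamma> b - \<gamma> a"
  using emeasure_Ioc[of a b] mono[of a b] by (simp add: measure_def)

lemma emeasure_finite:
  assumes "A \<subseteq> {0<..t}" shows "emeasure \<mu> A < \<infinity>"
proof (cases "0 \<le> t")
  case True
  have "emeasure \<mu> A \<le> emeasure \<mu> {0<..t}"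
    using assms by (intro emeasure_mono) auto
  also have "\<dots> < \<infinity>" using emeasure_Ioc[of 0 t] True by simp
  finally show ?thesis .
next
  case False
  with assms have "A = {}" by auto
  then show ?thesis by simp
qed

lemma measure_mono':
  assumes "A \<subseteq> B" "B \<subseteq> {0<..t}" "A \<in> sets borel" "B \<in> sets borel"
  shows "measure \<mu> A \<le> measure \<mu> B"
  using assms emeasure_finite[OF assms(2)]
  by (intro measure_mono_fmeasurable) (auto simp: fmeasurable_def)

lemma atom_le: "0 \<le> v \<Longrightarrow> v < s \<Longrightarrow> measure \<mu> {s} \<le> \<gamma> s - \<gamma> v"
  using measure_mono'[of "{s}" "{v<..s}" s] measure_Ioc[of v s] by fastforce

lemma atoms_sum:
  assumes "finite A" "A \<subseteq> {0<..t}"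
  shows "(\<Sum>s\<in>A. measure \<mu> {s}) = measure \<mu> A"
proof (rule measure_eq_sum_singleton[symmetric, OF assms(1)])
  fix x assume "x \<in> A"
  with assms show "{x} \<in> sets \<mu>" "emeasure \<mu> {x} \<noteq> \<infinity>"
    using emeasure_finite[of "{x}" t] by auto
qed

lemma atoms_sum_le:
  assumes "finite A" "A \<subseteq> {0<..t}" "0 \<le> t"
  shows "(\<Sum>s\<in>A. measure \<mu> {s}) \<le> \<gamma> t"
proof -
  have "measure \<mu> A \<le> measure \<mu> {0<..t}"
    using assms finite_imp_closed[of A] by (intro measure_mono') auto
  with assms atoms_sum[of A t] measure_Ioc[of 0 t] zero show ?thesis by simp
qed

text \<open>Exhaustion by half-open intervals, whose masses are increments of \<open>\<gamma>\<close> between interior points.\<close>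

lemma open_interval_le:
  assumes "0 \<le> a" "a < s" and bnd: "\<And>v. a < v \<Longrightarrow> v < s \<Longrightarrow> x \<le> \<gamma> v \<and> \<gamma> v \<le> y"
  shows "measure \<mu> {a<..<s} \<le> y - x"
proof -
  define \<delta> where "\<delta> n = (s - a) / real (n + 3)" for n
  have \<delta>: "0 < \<delta> n" "2 * \<delta> n < s - a" "\<delta> (Suc n) \<le> \<delta> n" for n
  proof -
    have c: "0 < s - a" using assms by simp
    show "0 < \<delta> n" using c by (simp add: \<delta>_def)
    have "2 / real (n + 3) < 1" by simp
    from mult_strict_right_mono[OF this c] show "2 * \<delta> n < s - a" by (simp add: \<delta>_def)
    show "\<delta> (Suc n) \<le> \<delta> n" unfolding \<delta>_def using c by (intro divide_left_mono) auto
  qed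
  define A where "A n = {a + \<delta> n<..s - \<delta> n}" for n
  have \<delta>0: "\<delta> \<longlonglongrightarrow> 0" unfolding \<delta>_def by real_asymp
  have U: "(\<Union>n. A n) = {a<..<s}"
  proof (intro equalityI subsetI)
    fix v assume v: "v \<in> {a<..<s}"
    then have "eventually (\<lambda>n. \<delta> n < min (v - a) (s - v)) sequentially"
      using \<delta>0 by (intro order_tendstoD) auto
    then obtain n where "\<delta> n < min (v - a) (s - v)" by (auto simp: eventually_sequentially)
    then show "v \<in> (\<Union>n. A n)" by (auto simp: A_def intro!: exI[of _ n])
  next
    fix v assume "v \<in> (\<Union>n. A n)"
    then obtain n where "v \<in> A n" by auto
    then show "v \<in> {a<..<s}" using \<delta>(1)[of n] by (auto simp: A_def)
  qed
  have "(\<lambda>n. measure \<mu> (A n)) \<longlonglongrightarrow> measure \<mu> (\<Union>n. A n)"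
  proof (rule Lim_measure_incseq)
    show "incseq A"
    proof (rule incseq_SucI)
      show "A n \<subseteq> A (Suc n)" for n using \<delta>(3)[of n] by (auto simp: A_def)
    qed
    show "emeasure \<mu> (\<Union>n. A n) \<noteq> \<infinity>"
      unfolding U using emeasure_finite[of "{a<..<s}" s] assms by fastforce
  qed (auto simp: A_def)
  moreover have "measure \<mu> (A n) \<le> y - x" for n
  proof -
    have "measure \<mu> (A n) = \<gamma> (s - \<delta> n) - \<gamma> (a + \<delta> n)"
      unfolding A_def using \<delta>[of n] assms by (intro measure_Ioc) auto
    then show ?thesis using bnd[of "s - \<delta> n"] bnd[of "a + \<delta> n"] \<delta>[of n] by auto
  qed
  ultimately show ?thesis unfolding U by (intro LIMSEQ_le_const2) auto
qed

lemma countable_atoms: "countable {s \<in> {0<..t}. measure \<mu> {s} \<noteq> 0}"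
proof -
  have "finite_measure (restrict_space \<mu> {0<..t})"
    using emeasure_finite[of "{0<..t}" t]
    by (intro finite_measureI) (auto simp: space_restrict_space emeasure_restrict_space)
  then have "countable {s. measure (restrict_space \<mu> {0<..t}) {s} \<noteq> 0}"
    by (rule finite_measure.countable_support)
  then show ?thesis
    by (rule countable_subset[rotated]) (auto simp: measure_restrict_space)
qed

lemma small_atoms_sets: "{s \<in> {0<..t}. 0 < measure \<mu> {s} \<and> measure \<mu> {s} < \<delta>} \<in> sets \<mu>"
proof (rule sets.countable)
  show "countable {s \<in> {0<..t}. 0 < measure \<mu> {s} \<and> measure \<mu> {s} < \<delta>}"
    by (rule countable_subset[OF _ countable_atoms[of t]]) auto
qed simp

text \<open>The sets of small atoms decrease to the empty set, inside a set of finite measure.\<close>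

lemma small_atoms_vanish:
  assumes \<theta>: "\<theta> \<longlonglongrightarrow> 0" "decseq \<theta>"
  shows "(\<lambda>n. measure \<mu> {s \<in> {0<..t}. 0 < measure \<mu> {s} \<and> measure \<mu> {s} < \<theta> n}) \<longlonglongrightarrow> 0"
proof -
  define A where "A n = {s \<in> {0<..t}. 0 < measure \<mu> {s} \<and> measure \<mu> {s} < \<theta> n}" for n
  have A: "A n \<in> sets \<mu>" for n
    unfolding A_def by (rule small_atoms_sets)
  have "(\<lambda>n. measure \<mu> (A n)) \<longlonglongrightarrow> measure \<mu> (\<Inter>n. A n)"
  proof (rule Lim_measure_decseq)
    show "decseq A" using \<theta>(2) unfolding decseq_def A_def by (auto intro: less_le_trans)
    show "emeasure \<mu> (A n) \<noteq> \<infinity>" for n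
    proof -
      have "A n \<subseteq> {0<..t}" by (auto simp: A_def)
      from emeasure_finite[OF this] show ?thesis by simp
    qed
  qed (use A in auto)
  moreover have "(\<Inter>n. A n) = {}"
  proof -
    have False if "\<And>n. s \<in> A n" for s
    proof -
      have "measure \<mu> {s} \<le> 0"
        using that by (intro LIMSEQ_le_const[OF \<theta>(1)]) (auto simp: A_def intro!: exI[of _ 0] less_imp_le)
      with that[of 0] show False by (auto simp: A_def)
    qed
    then show ?thesis by blast
  qed
  ultimately show ?thesis by (simp add: A_def)
qed

end

section \<open>The branching mechanism\<close>

lemma exp_minus_bounds:
  fixes x :: real assumes "0 \<le> x"
  shows "0 \<le> exp (- x) - 1 + x" "exp (- x) - 1 + x \<le> x\<^sup>2"
proof -
  show "0 \<le> exp (- x) - 1 + x" using exp_ge_add_one_self[of "- x"] by simp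
  have "exp (- x) * (1 + x) \<le> exp (- x) * exp x"
    using exp_ge_add_one_self[of x] by (intro mult_left_mono) auto
  then have "exp (- x) * (1 + x) \<le> 1" by (simp flip: exp_add)
  then have "(exp (- x) - 1 + x) * (1 + x) \<le> x\<^sup>2 * 1"
    by (simp add: algebra_simps power2_eq_square)
  also have "\<dots> \<le> x\<^sup>2 * (1 + x)" using assms by (intro mult_left_mono) auto
  finally show "exp (- x) - 1 + x \<le> x\<^sup>2" using assms by (simp add: mult_le_cancel_right)
qed

text \<open>The kernel is of order $z^2$ at small \<open>z\<close> and bounded at large \<open>z\<close>; this makes the integral against \<open>m s\<close>
  an integral of a bounded function against a finite measure.\<close>

lemma K1_ratio_bound:
  assumes "0 \<le> \<theta>" "0 < z"
  shows "\<bar>K1 \<theta> z / min 1 (z\<^sup>2)\<bar> \<le> 1 + \<theta>\<^sup>2"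
proof (cases "z \<le> 1")
  case True
  then have "min 1 (z\<^sup>2) = z\<^sup>2" using assms by (simp add: power_le_one min_absorb2)
  moreover have "0 \<le> K1 \<theta> z" "K1 \<theta> z \<le> (\<theta> * z)\<^sup>2"
    using exp_minus_bounds[of "\<theta> * z"] True assms by (simp_all add: K1_def)
  ultimately have "\<bar>K1 \<theta> z / min 1 (z\<^sup>2)\<bar> \<le> (\<theta> * z)\<^sup>2 / z\<^sup>2"
    by (simp add: divide_right_mono)
  with assms show ?thesis by (simp add: power_mult_distrib)
next
  case False
  then have "1 \<le> z\<^sup>2" by (intro one_le_power) auto
  moreover have "0 < exp (- \<theta> * z)" "exp (- \<theta> * z) \<le> 1" using assms by auto
  then have "\<bar>K1 \<theta> z\<bar> \<le> 1" using False by (simp add: K1_def)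
  ultimately show ?thesis by simp (smt (verit) zero_le_power2)
qed

lemma K1_measurable [measurable]: "K1 \<theta> \<in> borel_measurable borel"
  unfolding K1_def[abs_def] by measurable

text \<open>A single constant \<open>K \<ge> 1\<close> bounds the drift, the quadratic coefficient and the mass of the
  weighted kernel, as the scaling $\beta_k=12Kk$ requires.\<close>

locale branching_parameters = increasing_path \<gamma> for \<gamma> :: "real \<Rightarrow> real" +
  fixes b1 c :: "real \<Rightarrow> real" and m :: "real \<Rightarrow> real measure" and K :: real
  assumes K: "1 \<le> K"
    and b1_measurable: "b1 \<in> borel_measurable (restrict_space borel {0..})"
    and b1_bound: "0 \<le> s \<Longrightarrow> \<bar>b1 s\<bar> \<le> K"
    and c_measurable: "c \<in> borel_measurable (restrict_space borel {0..})"
    and c_bound: "0 \<le> s \<Longrightarrow> 0 \<le> c s \<and> c s \<le> K"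
    and sets_m: "0 \<le> s \<Longrightarrow> sets (m s) = sets (restrict_space borel {0<..})"
    and kernel_measurable: "B \<in> sets (restrict_space borel {0<..}) \<Longrightarrow>
        (\<lambda>s. emeasure (density (m s) (\<lambda>z. ennreal (min 1 (z\<^sup>2)))) B)
          \<in> borel_measurable (restrict_space borel {0..})"
    and kernel_bound: "0 \<le> s \<Longrightarrow>
        emeasure (density (m s) (\<lambda>z. ennreal (min 1 (z\<^sup>2)))) {0<..} \<le> ennreal K"
    and c_atom: "0 < s \<Longrightarrow> c s * measure \<mu> {s} = 0"
    and drift_atom: "0 < s \<Longrightarrow> (ereal (b1 s) + enn2ereal (\<integral>\<^sup>+z\<in>{0<..1}. ennreal z \<partial>m s))
              * ereal (measure \<mu> {s}) \<le> 1"
begin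

abbreviation \<phi> :: "real \<Rightarrow> real \<Rightarrow> real" where "\<phi> \<equiv> phi b1 c m"

definition \<kappa> :: "real \<Rightarrow> real measure" where
  "\<kappa> s = density (m s) (\<lambda>z. ennreal (min 1 (z\<^sup>2)))"

lemma space_m: "0 \<le> s \<Longrightarrow> space (m s) = {0<..}"
  using sets_eq_imp_space_eq[OF sets_m] by (simp add: space_restrict_space)

lemma measurable_m:
  assumes "0 \<le> s" "f \<in> borel_measurable borel" shows "f \<in> borel_measurable (m s)"
  using measurable_restrict_space1[OF assms(2)] measurable_cong_sets[OF sets_m[OF assms(1)] refl]
  by blast

lemma sets_\<kappa>: "0 \<le> s \<Longrightarrow> sets (\<kappa> s) = sets (restrict_space borel {0<..})"
  by (simp add: \<kappa>_def sets_m)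

lemma space_\<kappa>: "0 \<le> s \<Longrightarrow> space (\<kappa> s) = {0<..}"
  by (simp add: \<kappa>_def space_m)

lemma measurable_\<kappa>:
  assumes "0 \<le> s" "f \<in> borel_measurable borel" shows "f \<in> borel_measurable (\<kappa> s)"
  using measurable_m[OF assms] by (simp add: \<kappa>_def)

lemma finite_measure_\<kappa>: "0 \<le> s \<Longrightarrow> finite_measure (\<kappa> s)"
  using kernel_bound[of s]
  by (intro finite_measureI) (auto simp: \<kappa>_def[symmetric] space_\<kappa> top_unique)

lemma \<kappa>_mass:
  assumes "0 \<le> s" shows "measure (\<kappa> s) (space (\<kappa> s)) \<le> K"
proof -
  have "emeasure (\<kappa> s) (space (\<kappa> s)) \<le> ennreal K"
    using kernel_bound[OF assms] assms by (simp add: \<kappa>_def[symmetric] space_\<kappa>)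
  with K show ?thesis unfolding measure_def by (intro enn2real_leI) auto
qed

lemma K1_ratio_integrable:
  assumes s: "0 \<le> s" and \<theta>: "0 \<le> \<theta>"
  shows "integrable (\<kappa> s) (\<lambda>z. K1 \<theta> z / min 1 (z\<^sup>2))"
proof -
  interpret finite_measure "\<kappa> s" by (rule finite_measure_\<kappa>[OF s])
  show ?thesis
    using K1_ratio_bound[OF \<theta>] s
    by (intro integrable_const_bound[of _ "1 + \<theta>\<^sup>2"] AE_I2 measurable_\<kappa>) (auto simp: space_\<kappa>)
qed

lemma phi_eq:
  assumes s: "0 \<le> s"
  shows "\<phi> s \<theta> = b1 s * \<theta> + c s * \<theta>\<^sup>2 + (LINT z|\<kappa> s. K1 \<theta> z / min 1 (z\<^sup>2))"
proof -
  have "(LINT z|\<kappa> s. K1 \<theta> z / min 1 (z\<^sup>2)) = (LINT z|m s. min 1 (z\<^sup>2) *\<^sub>R (K1 \<theta> z / min 1 (z\<^sup>2)))"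
    unfolding \<kappa>_def using s by (intro integral_density measurable_m) auto
  also have "\<dots> = (LINT z|m s. K1 \<theta> z)"
  proof (rule Bochner_Integration.integral_cong)
    fix z assume "z \<in> space (m s)"
    then have "0 < min 1 (z\<^sup>2)" using s by (simp add: space_m)
    then have "min 1 (z\<^sup>2) \<noteq> 0" by linarith
    then show "min 1 (z\<^sup>2) *\<^sub>R (K1 \<theta> z / min 1 (z\<^sup>2)) = K1 \<theta> z"
      unfolding real_scaleR_def by (metis nonzero_mult_div_cancel_left times_divide_eq_right)
  qed simp
  finally show ?thesis by (simp add: phi_def)
qed

lemma phi_bound:
  assumes s: "0 \<le> s" and \<theta>: "0 \<le> \<theta>" "\<theta> \<le> M"
  shows "\<bar>\<phi> s \<theta>\<bar> \<le> 2 * K * (1 + M)\<^sup>2"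
proof -
  interpret finite_measure "\<kappa> s" by (rule finite_measure_\<kappa>[OF s])
  have "\<bar>LINT z|\<kappa> s. K1 \<theta> z / min 1 (z\<^sup>2)\<bar> \<le> (LINT z|\<kappa> s. \<bar>K1 \<theta> z / min 1 (z\<^sup>2)\<bar>)"
    by (rule integral_abs_bound)
  also have "\<dots> \<le> (LINT z|\<kappa> s. 1 + \<theta>\<^sup>2)"
    using K1_ratio_integrable[OF s \<theta>(1)] K1_ratio_bound[OF \<theta>(1)] s
    by (intro integral_mono integrable_abs) (auto simp: space_\<kappa>)
  also have "\<dots> = measure (\<kappa> s) (space (\<kappa> s)) * (1 + \<theta>\<^sup>2)" by simp
  also have "\<dots> \<le> K * (1 + \<theta>\<^sup>2)" using \<kappa>_mass[OF s] by (intro mult_right_mono) auto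
  finally have 1: "\<bar>LINT z|\<kappa> s. K1 \<theta> z / min 1 (z\<^sup>2)\<bar> \<le> K * (1 + \<theta>\<^sup>2)" .
  have 2: "\<bar>b1 s * \<theta>\<bar> \<le> K * \<theta>"
    using b1_bound[OF s] \<theta> by (auto simp: abs_mult intro!: mult_right_mono)
  have 3: "\<bar>c s * \<theta>\<^sup>2\<bar> \<le> K * \<theta>\<^sup>2"
    using c_bound[OF s] by (auto simp: abs_mult intro!: mult_right_mono)
  have "\<bar>\<phi> s \<theta>\<bar> \<le> K * \<theta> + K * \<theta>\<^sup>2 + K * (1 + \<theta>\<^sup>2)"
    unfolding phi_eq[OF s] using 1 2 3 by linarith
  also have "\<dots> \<le> 2 * K * (1 + \<theta>)\<^sup>2"
    using K \<theta> by (simp add: power2_eq_square algebra_simps)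
  also have "\<dots> \<le> 2 * K * (1 + M)\<^sup>2"
    using K \<theta> by (intro mult_left_mono power_mono) auto
  finally show ?thesis .
qed

text \<open>After division by \<open>K\<close> the weighted kernel is sub-Markovian, so integration against it preserves measurability.\<close>

lemma phi_measurable: "(\<lambda>s. \<phi> s \<theta>) \<in> borel_measurable (restrict_space borel {0..})"
proof -
  define \<kappa>' where "\<kappa>' s = density (\<kappa> s) (\<lambda>_. ennreal (1 / K))" for s
  have \<kappa>'_emeasure: "emeasure (\<kappa>' s) B = ennreal (1 / K) * emeasure (\<kappa> s) B"
    if "0 \<le> s" "B \<in> sets (restrict_space borel {0<..})" for s B
    unfolding \<kappa>'_def using that by (intro emeasure_density_const) (simp add: sets_\<kappa>)
  have "\<kappa>' \<in> measurable (restrict_space borel {0..}) (subprob_algebra (restrict_space borel {0<..}))"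
  proof (rule measurable_subprob_algebra)
    fix s :: real assume "s \<in> space (restrict_space borel {0..})"
    then have s: "0 \<le> s" by (simp add: space_restrict_space)
    show sets: "sets (\<kappa>' s) = sets (restrict_space borel {0<..})"
      by (simp add: \<kappa>'_def sets_\<kappa>[OF s])
    have space: "space (\<kappa>' s) = {0<..}" by (simp add: \<kappa>'_def space_\<kappa>[OF s])
    show "subprob_space (\<kappa>' s)"
    proof
      have "emeasure (\<kappa>' s) (space (\<kappa>' s)) = ennreal (1 / K) * emeasure (\<kappa> s) {0<..}"
        using s unfolding space by (intro \<kappa>'_emeasure) (auto simp: sets_restrict_space)
      also have "\<dots> \<le> ennreal (1 / K) * ennreal K"
        using kernel_bound[OF s] by (intro mult_left_mono) (auto simp: \<kappa>_def)
      also have "\<dots> = 1" using K by (simp flip: ennreal_mult)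
      finally show "emeasure (\<kappa>' s) (space (\<kappa>' s)) \<le> 1" .
      show "space (\<kappa>' s) \<noteq> {}" unfolding space using greaterThan_non_empty by blast
    qed
  next
    fix B assume B: "B \<in> sets (restrict_space borel {0::real<..})"
    have "(\<lambda>s. ennreal (1 / K) * emeasure (\<kappa> s) B) \<in> borel_measurable (restrict_space borel {0..})"
      using kernel_measurable[OF B] unfolding \<kappa>_def by measurable
    then show "(\<lambda>s. emeasure (\<kappa>' s) B) \<in> borel_measurable (restrict_space borel {0..})"
      by (rule measurable_cong[THEN iffD1, rotated])
        (use B in \<open>auto simp: \<kappa>'_emeasure space_restrict_space\<close>)
  qed
  moreover have "(\<lambda>z. K1 \<theta> z / min 1 (z\<^sup>2)) \<in> borel_measurable (restrict_space borel {0<..})"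
    by (intro measurable_restrict_space1) measurable
  ultimately have "(\<lambda>s. LINT z|\<kappa>' s. K1 \<theta> z / min 1 (z\<^sup>2)) \<in> borel_measurable (restrict_space borel {0..})"
    by (intro measurable_compose[OF _ integral_measurable_subprob_algebra])
  then have "(\<lambda>s. b1 s * \<theta> + c s * \<theta>\<^sup>2 + K * (LINT z|\<kappa>' s. K1 \<theta> z / min 1 (z\<^sup>2)))
      \<in> borel_measurable (restrict_space borel {0..})"
    by (intro borel_measurable_add borel_measurable_times b1_measurable c_measurable
        borel_measurable_const)
  then show ?thesis
  proof (rule measurable_cong[THEN iffD1, rotated])
    fix s :: real assume "s \<in> space (restrict_space borel {0..})"
    then have s: "0 \<le> s" by (simp add: space_restrict_space)
    have "(LINT z|\<kappa>' s. K1 \<theta> z / min 1 (z\<^sup>2)) = (LINT z|\<kappa> s. (1 / K) *\<^sub>R (K1 \<theta> z / min 1 (z\<^sup>2)))"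
      unfolding \<kappa>'_def using K s by (intro integral_density measurable_\<kappa>) auto
    also have "\<dots> = (1 / K) * (LINT z|\<kappa> s. K1 \<theta> z / min 1 (z\<^sup>2))"
      unfolding real_scaleR_def by (rule integral_mult_right_zero)
    finally show "b1 s * \<theta> + c s * \<theta>\<^sup>2 + K * (LINT z|\<kappa>' s. K1 \<theta> z / min 1 (z\<^sup>2)) = \<phi> s \<theta>"
      using K by (simp add: phi_eq[OF s])
  qed
qed

text \<open>The branching mechanism frozen at one time. The perturbation of the identity is one third of the sum
  of three perturbations: the drift together with a square that makes its constant coefficient
  nonnegative, a nonnegative multiple of the square, and the average of the single-jump perturbations. The
  correction $2K/k$ pays for the squares that are attached to the first and to the third of them.\<close>

lemma is_pgf_local:
  assumes s: "0 \<le> s" and k: "1 \<le> k" and \<beta>: "12 * K * k \<le> \<beta>"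
  shows "is_pgf (\<lambda>w. w + (\<phi> s (k * (1 - w)) + 2 * K / k * (k * (1 - w))\<^sup>2) / (k * \<beta>))"
proof -
  interpret finite_measure "\<kappa> s" by (rule finite_measure_\<kappa>[OF s])
  define \<tau> where "\<tau> = measure (\<kappa> s) (space (\<kappa> s))"
  have \<tau>: "0 \<le> \<tau>" "\<tau> \<le> K" using \<kappa>_mass[OF s] by (auto simp: \<tau>_def)
  have Kk: "1 \<le> K * k" "K \<le> K * k" using K k mult_mono[of 1 K 1 k] by auto
  have \<beta>0: "0 < \<beta>" using \<beta> Kk by linarith
  have k0: "0 < k" using k by simp
  have b: "- K \<le> b1 s" "b1 s \<le> K" using b1_bound[OF s] by auto
  have cc: "0 \<le> c s" "c s \<le> K" using c_bound[OF s] by auto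
  have "is_pgf (\<lambda>w. 3 / \<beta> * (b1 s + K) + (1 - 3 / \<beta> * (b1 s + 2 * K)) * w + 3 / \<beta> * K * w\<^sup>2)"
  proof (rule is_pgf_quadratic)
    have "3 * (b1 s + 2 * K) \<le> \<beta>" using \<beta> Kk b by (simp add: algebra_simps)
    with \<beta>0 show "0 \<le> 1 - 3 / \<beta> * (b1 s + 2 * K)" by (simp add: field_simps)
  qed (use \<beta>0 b K in \<open>auto simp: field_simps\<close>)
  then have f1: "is_pgf (\<lambda>w. w + 3 / \<beta> * (b1 s * (1 - w) + K * (1 - w)\<^sup>2))"
    by (rule is_pgf_cong[rotated]) (use \<beta>0 in \<open>simp add: field_simps power2_eq_square\<close>)
  \<comment> \<open>The quadratic part of the mechanism and the correction, less the squares that are spent on the drift in \<open>f1\<close> and on the jumps in \<open>f3\<close>.\<close>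
  define e where "e = 3 * (c s * k\<^sup>2 + K * k - \<tau>) / (k * \<beta>)"
  have e0: "0 \<le> e"
  proof -
    have "0 \<le> c s * k\<^sup>2" using cc by simp
    with \<tau> Kk have "0 \<le> c s * k\<^sup>2 + K * k - \<tau>" by linarith
    then show ?thesis unfolding e_def using k0 \<beta>0 by simp
  qed
  have e2: "2 * e \<le> 1"
  proof -
    have "c s * k\<^sup>2 \<le> K * k\<^sup>2" using cc by (intro mult_right_mono) auto
    moreover have "K * k \<le> K * k\<^sup>2" using K k by (simp add: power2_eq_square)
    moreover have "(12 * K * k) * k \<le> \<beta> * k" using \<beta> k0 by (intro mult_right_mono) auto
    ultimately have "2 * (3 * (c s * k\<^sup>2 + K * k - \<tau>)) \<le> k * \<beta>"
      using \<tau> by (simp add: power2_eq_square algebra_simps)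
    then show ?thesis unfolding e_def using k0 \<beta>0 by (simp add: field_simps)
  qed
  have "is_pgf (\<lambda>w. e + (1 - 2 * e) * w + e * w\<^sup>2)"
    using e0 e2 by (intro is_pgf_quadratic) auto
  then have f2: "is_pgf (\<lambda>w. w + e * (1 - w)\<^sup>2)"
    by (rule is_pgf_cong[rotated]) (simp add: algebra_simps power2_eq_square)
  define \<epsilon> where "\<epsilon> = 3 / (k * \<beta>)"
  have \<epsilon>: "0 \<le> \<epsilon>" using k0 \<beta>0 by (simp add: \<epsilon>_def)
  have f3: "is_pgf (\<lambda>w. w + (LINT z|\<kappa> s. \<epsilon> * (K1 (k * (1 - w)) z / min 1 (z\<^sup>2) + (1 - w)\<^sup>2)))"
  proof (rule is_pgf_perturbation_mixture[where r = K])
    fix z assume "z \<in> space (\<kappa> s)"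
    then have z: "0 < z" by (simp add: space_\<kappa>[OF s])
    have "K * \<epsilon> * (k\<^sup>2 + 2) \<le> 1"
    proof -
      have "1 \<le> k\<^sup>2" using k by (rule one_le_power)
      then have "3 * K * (k\<^sup>2 + 2) \<le> 3 * K * (3 * k\<^sup>2)"
        using K by (intro mult_left_mono) auto
      also have "\<dots> \<le> (12 * K * k) * k" using K by (simp add: power2_eq_square)
      also have "\<dots> \<le> \<beta> * k" using \<beta> k0 by (intro mult_right_mono) auto
      finally show ?thesis unfolding \<epsilon>_def using k0 \<beta>0 by (simp add: field_simps)
    qed
    then have "is_pgf (\<lambda>w. w + K * \<epsilon> * (K1 (k * (1 - w)) z / min 1 (z\<^sup>2) + (1 - w)\<^sup>2))"
      using k z K \<epsilon> by (intro is_pgf_id_plus_K1) auto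
    then show "is_pgf (\<lambda>w. w + K * (\<epsilon> * (K1 (k * (1 - w)) z / min 1 (z\<^sup>2) + (1 - w)\<^sup>2)))"
      by (simp add: mult.assoc)
  next
    show "(\<lambda>z. \<epsilon> * (K1 (k * (1 - w)) z / min 1 (z\<^sup>2) + (1 - w)\<^sup>2)) \<in> borel_measurable (\<kappa> s)" for w
      using s by (intro measurable_\<kappa>) auto
  qed (use K \<kappa>_mass[OF s] in \<open>auto simp: is_pgf_id finite_measure_axioms\<close>)
  show ?thesis
  proof (rule is_pgf_cong[OF _ is_pgf_average3[OF f1 f2 f3]])
    fix w :: real assume w: "w \<in> {0..1}"
    define X where "X = (LINT z|\<kappa> s. K1 (k * (1 - w)) z / min 1 (z\<^sup>2))"
    have I: "(LINT z|\<kappa> s. \<epsilon> * (K1 (k * (1 - w)) z / min 1 (z\<^sup>2) + (1 - w)\<^sup>2)) = \<epsilon> * (X + \<tau> * (1 - w)\<^sup>2)"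
      using K1_ratio_integrable[OF s, of "k * (1 - w)"] w k0 by (simp add: X_def \<tau>_def)
    have P: "\<phi> s (k * (1 - w)) = b1 s * (k * (1 - w)) + c s * (k * (1 - w))\<^sup>2 + X"
      by (simp add: phi_eq[OF s] X_def)
    show "(w + 3 / \<beta> * (b1 s * (1 - w) + K * (1 - w)\<^sup>2) + (w + e * (1 - w)\<^sup>2) +
        (w + (LINT z|\<kappa> s. \<epsilon> * (K1 (k * (1 - w)) z / min 1 (z\<^sup>2) + (1 - w)\<^sup>2)))) / 3 =
        w + (\<phi> s (k * (1 - w)) + 2 * K / k * (k * (1 - w))\<^sup>2) / (k * \<beta>)"
      unfolding I P unfolding e_def \<epsilon>_def using k0 \<beta>0 by (simp add: field_simps power2_eq_square)
  qed
qed

end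

section \<open>Generating functions for intervals and for atoms\<close>

context branching_parameters begin

lemma phi_measurable_restrict:
  assumes "0 \<le> a"
  shows "(\<lambda>s. \<phi> s \<theta>) \<in> borel_measurable (restrict_space \<mu> {a<..<t})"
proof -
  have "(\<lambda>s. \<phi> s \<theta>) \<in> borel_measurable (restrict_space borel {a<..<t})"
    by (rule measurable_restrict_mono[OF phi_measurable]) (use assms in auto)
  then show ?thesis
    using measurable_cong_sets[OF sets_restrict_space_cong[OF sets_\<mu>] refl] by blast
qed

lemma finite_measure_interval: "0 \<le> a \<Longrightarrow> finite_measure (restrict_space \<mu> {a<..<t})"
proof (intro finite_measureI)
  assume "0 \<le> a"
  then have "{a<..<t} \<subseteq> {0<..t}" by auto
  from emeasure_finite[OF this] show
    "emeasure (restrict_space \<mu> {a<..<t}) (space (restrict_space \<mu> {a<..<t})) \<noteq> \<infinity>"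
    by (simp add: space_restrict_space emeasure_restrict_space)
qed

lemma phi_integrable:
  assumes "0 \<le> a" "0 \<le> \<theta>"
  shows "integrable (restrict_space \<mu> {a<..<t}) (\<lambda>s. \<phi> s \<theta>)"
proof -
  interpret finite_measure "restrict_space \<mu> {a<..<t}" by (rule finite_measure_interval[OF assms(1)])
  show ?thesis
    using phi_bound[of _ \<theta> \<theta>] assms
    by (intro integrable_const_bound[of _ "2 * K * (1 + \<theta>)\<^sup>2"] AE_I2 phi_measurable_restrict)
      (auto simp: space_restrict_space)
qed

lemma set_integral_restrict: "(LINT u:{a<..<t}|\<mu>. f u) = (LINT u|restrict_space \<mu> {a<..<t}. f u)"
  for f :: "real \<Rightarrow> real"
  unfolding set_lebesgue_integral_def by (subst integral_restrict_space) auto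

definition interval_pgf :: "real \<Rightarrow> real \<Rightarrow> real \<Rightarrow> real \<Rightarrow> real" where
  "interval_pgf k a t w =
     w + (LINT u:{a<..<t}|\<mu>. \<phi> u (k * (1 - w)) + 2 * K / k * (k * (1 - w))\<^sup>2) / k"

text \<open>Averaging \<open>is_pgf_local\<close> over the interval; the mass bound is what allows mixing weights
  proportional to \<open>\<mu>\<close>.\<close>

lemma is_pgf_interval:
  assumes a: "0 \<le> a" and k: "1 \<le> k" and \<beta>: "12 * K * k \<le> \<beta>"
    and mass: "measure \<mu> {a<..<t} \<le> 1 / \<beta>"
  shows "is_pgf (interval_pgf k a t)"
proof -
  let ?\<nu> = "restrict_space \<mu> {a<..<t}"
  let ?\<psi> = "\<lambda>u w. \<phi> u (k * (1 - w)) + 2 * K / k * (k * (1 - w))\<^sup>2"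
  have \<beta>0: "0 < \<beta>" using \<beta> K k mult_mono[of 1 K 1 k] by auto
  have "is_pgf (\<lambda>w. w + (LINT u|?\<nu>. ?\<psi> u w / k))"
  proof (rule is_pgf_perturbation_mixture[where r = "1 / \<beta>"])
    show "measure ?\<nu> (space ?\<nu>) \<le> 1 / \<beta>"
      using mass by (simp add: space_restrict_space measure_restrict_space)
    fix u assume "u \<in> space ?\<nu>"
    then have "0 \<le> u" using a by (simp add: space_restrict_space)
    from is_pgf_local[OF this k \<beta>] show "is_pgf (\<lambda>w. w + 1 / \<beta> * (?\<psi> u w / k))"
      by (simp add: mult.commute)
  next
    show "(\<lambda>u. ?\<psi> u w / k) \<in> borel_measurable ?\<nu>" for w
      by (intro borel_measurable_divide borel_measurable_add phi_measurable_restrict[OF a]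
          borel_measurable_const)
  qed (use finite_measure_interval[OF a] \<beta>0 in \<open>auto simp: is_pgf_id\<close>)
  then show ?thesis
    by (simp add: interval_pgf_def[abs_def] set_integral_restrict)
qed

text \<open>The approximation is exact except for the correction $(2K/k)\lambda^2$.\<close>

lemma interval_pgf_error:
  assumes a: "0 \<le> a" and k: "1 \<le> k" and mass: "measure \<mu> {a<..<t} \<le> 1 / \<beta>" "0 < \<beta>"
    and \<theta>: "0 \<le> \<theta>" "\<theta> \<le> M"
  shows "\<bar>k * (interval_pgf k a t (1 - \<theta> / k) - (1 - \<theta> / k)) - (LINT u:{a<..<t}|\<mu>. \<phi> u \<theta>)\<bar>
    \<le> 2 * K * M\<^sup>2 / (k * \<beta>)"
proof -
  interpret finite_measure "restrict_space \<mu> {a<..<t}" by (rule finite_measure_interval[OF a])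
  define \<tau> where "\<tau> = measure \<mu> {a<..<t}"
  have "k * (1 - (1 - \<theta> / k)) = \<theta>" using k by simp
  then have "k * (interval_pgf k a t (1 - \<theta> / k) - (1 - \<theta> / k))
      = (LINT u|restrict_space \<mu> {a<..<t}. \<phi> u \<theta> + 2 * K / k * \<theta>\<^sup>2)"
    using k by (simp add: interval_pgf_def set_integral_restrict)
  also have "\<dots> = (LINT u:{a<..<t}|\<mu>. \<phi> u \<theta>) + \<tau> * (2 * K / k * \<theta>\<^sup>2)"
    using phi_integrable[OF a \<theta>(1)]
    by (simp add: set_integral_restrict \<tau>_def space_restrict_space measure_restrict_space)
  finally have "\<bar>k * (interval_pgf k a t (1 - \<theta> / k) - (1 - \<theta> / k)) - (LINT u:{a<..<t}|\<mu>. \<phi> u \<theta>)\<bar>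
      = \<tau> * (2 * K / k * \<theta>\<^sup>2)" using K k by (simp add: \<tau>_def)
  also have "\<dots> \<le> 1 / \<beta> * (2 * K / k * M\<^sup>2)"
    using mass K k \<theta> by (intro mult_mono power_mono) (auto simp: \<tau>_def)
  finally show ?thesis by (simp add: field_simps)
qed

definition atom_pgf :: "real \<Rightarrow> real \<Rightarrow> real \<Rightarrow> real" where
  "atom_pgf k s w = exp (- ((k * (1 - w) - measure \<mu> {s} * \<phi> s (k * (1 - w))) / k))"

text \<open>By the bound on the drift at atoms, the exponent is minus the sum of $q(1-w)$, with $q\ge0$, and of a
  multiple of $\int(1-e^{-k(1-w)z})m(s,dz)$; the function is thus a Poisson generating function times a
  compound Poisson one. The measure \<open>m s\<close> may be infinite near 0, but an atom of \<open>\<mu>\<close> forces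
  $\int(1\wedge z)m(s,dz)<\infty$, so that a mixture with respect to the finite measure $(1\wedge z)m(s,dz)$ is available.\<close>

lemma is_pgf_atom:
  assumes s: "0 < s" and atom: "0 < measure \<mu> {s}" and k: "1 \<le> k"
  shows "is_pgf (atom_pgf k s)"
proof -
  define \<Delta> where "\<Delta> = measure \<mu> {s}"
  have \<Delta>: "0 < \<Delta>" using atom by (simp add: \<Delta>_def)
  have s0: "0 \<le> s" using s by simp
  note [measurable] = measurable_m[OF s0]
  have c0: "c s = 0" using c_atom[OF s] atom by simp
  define I where "I = (\<integral>\<^sup>+z\<in>{0<..1}. ennreal z \<partial>m s)"
  have drift: "(ereal (b1 s) + enn2ereal I) * ereal \<Delta> \<le> 1"
    using drift_atom[OF s] by (simp add: I_def \<Delta>_def)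
  have Ifin: "I < \<infinity>"
  proof (rule ccontr)
    assume "\<not> I < \<infinity>"
    then have "I = \<infinity>" by (metis infinity_ennreal_def less_top)
    then have "(ereal (b1 s) + enn2ereal I) * ereal \<Delta> = \<infinity>" using \<Delta> by (simp add: top_ereal_def)
    with drift show False by simp
  qed
  define \<iota> where "\<iota> = enn2real I"
  have "enn2ereal I = ereal \<iota>"
    using Ifin unfolding \<iota>_def by (cases I) (auto simp: enn2ereal_ennreal)
  with drift have q: "(b1 s + \<iota>) * \<Delta> \<le> 1" by (simp add: one_ereal_def)
  have small_nn: "(\<integral>\<^sup>+z. ennreal (z * indicator {..1} z) \<partial>m s) = I"
    unfolding I_def by (intro nn_integral_cong) (auto simp: space_m[OF s0] indicator_def)
  have small_int: "integrable (m s) (\<lambda>z. z * indicator {..1} z)"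
    and \<iota>: "(LINT z|m s. z * indicator {..1} z) = \<iota>"
  proof -
    show "integrable (m s) (\<lambda>z. z * indicator {..1} z)"
    proof (rule integrableI_nonneg)
      show "(\<lambda>z. z * indicator {..1} z) \<in> borel_measurable (m s)" by (rule measurable_m[OF s0]) measurable
      show "AE z in m s. 0 \<le> z * indicator {..1} z" by (rule AE_I2) (auto simp: space_m[OF s0])
    qed (use small_nn Ifin in simp)
    show "(LINT z|m s. z * indicator {..1} z) = \<iota>"
    proof (subst integral_eq_nn_integral)
      show "(\<lambda>z. z * indicator {..1} z) \<in> borel_measurable (m s)" by (rule measurable_m[OF s0]) measurable
      show "AE z in m s. 0 \<le> z * indicator {..1} z" by (rule AE_I2) (auto simp: space_m[OF s0])
    qed (simp add: small_nn \<iota>_def)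
  qed
  have min_meas: "(\<lambda>z. min 1 z) \<in> borel_measurable (m s)" by (rule measurable_m[OF s0]) measurable
  have min_nn: "(\<integral>\<^sup>+z. ennreal (min 1 z) \<partial>m s) < \<infinity>"
  proof -
    have "(\<integral>\<^sup>+z. ennreal (min 1 z) \<partial>m s)
        \<le> (\<integral>\<^sup>+z. ennreal (z * indicator {..1} z) + ennreal (min 1 (z\<^sup>2)) \<partial>m s)"
    proof (rule nn_integral_mono)
      fix z assume "z \<in> space (m s)"
      then have z: "0 < z" by (simp add: space_m[OF s0])
      have "min 1 z \<le> z * indicator {..1} z + min 1 (z\<^sup>2)"
      proof (cases "z \<le> 1")
        case False
        then have "1 \<le> z\<^sup>2" by (intro one_le_power) auto
        then show ?thesis using False by simp
      qed (use z in auto)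
      then show "ennreal (min 1 z) \<le> ennreal (z * indicator {..1} z) + ennreal (min 1 (z\<^sup>2))"
        using z by (simp add: ennreal_leI del: ennreal_plus flip: ennreal_plus)
    qed
    also have "\<dots> = (\<integral>\<^sup>+z. ennreal (z * indicator {..1} z) \<partial>m s) + (\<integral>\<^sup>+z. ennreal (min 1 (z\<^sup>2)) \<partial>m s)"
      by (intro nn_integral_add measurable_m[OF s0]) auto
    also have "(\<integral>\<^sup>+z. ennreal (min 1 (z\<^sup>2)) \<partial>m s) = emeasure (\<kappa> s) (space (m s))"
      unfolding \<kappa>_def by (subst emeasure_density) (auto intro!: nn_integral_cong measurable_m[OF s0])
    also have "\<dots> \<le> ennreal K"
      using kernel_bound[OF s0] by (simp add: \<kappa>_def space_m[OF s0])
    finally have "(\<integral>\<^sup>+z. ennreal (min 1 z) \<partial>m s) \<le> I + ennreal K"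
      unfolding small_nn by (simp add: add_left_mono)
    also have "\<dots> < \<infinity>" using Ifin by simp
    finally show ?thesis .
  qed
  have min_int: "integrable (m s) (\<lambda>z. min 1 z)"
    using min_nn by (intro integrableI_nonneg min_meas) (auto intro!: AE_I2 simp: space_m[OF s0])
  have exp_bound: "0 \<le> 1 - exp (- (x * z))" "1 - exp (- (x * z)) \<le> (1 + x) * min 1 z" if "0 \<le> x" "0 < z" for x z :: real
  proof -
    show "0 \<le> 1 - exp (- (x * z))" using mult_nonneg_nonneg[of x z] that by simp
    have "1 - exp (- (x * z)) \<le> x * z" using exp_minus_bounds(1)[of "x * z"] mult_nonneg_nonneg[of x z] that by simp
    also have "x * z \<le> (1 + x) * z" using that by (intro mult_right_mono) auto
    finally have "1 - exp (- (x * z)) \<le> (1 + x) * z" .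
    moreover have "1 - exp (- (x * z)) \<le> 1 + x" using that exp_gt_zero[of "- (x * z)"] by linarith
    ultimately show "1 - exp (- (x * z)) \<le> (1 + x) * min 1 z" by (simp add: min_def)
  qed
  have exp_int: "integrable (m s) (\<lambda>z. 1 - exp (- (x * z)))" if "0 \<le> x" for x :: real
  proof (rule Bochner_Integration.integrable_bound)
    show "integrable (m s) (\<lambda>z. (1 + x) * min 1 z)" using min_int by simp
    show "(\<lambda>z. 1 - exp (- (x * z))) \<in> borel_measurable (m s)" by (rule measurable_m[OF s0]) measurable
    show "AE z in m s. norm (1 - exp (- (x * z))) \<le> norm ((1 + x) * min 1 z)"
    proof (rule AE_I2)
      fix z assume "z \<in> space (m s)"
      then have "0 < z" by (simp add: space_m[OF s0])
      from exp_bound[OF that this] show "norm (1 - exp (- (x * z))) \<le> norm ((1 + x) * min 1 z)" by simp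
    qed
  qed
  have phi_atom: "\<phi> s x = (b1 s + \<iota>) * x - (LINT z|m s. 1 - exp (- (x * z)))" if "0 \<le> x" for x
  proof -
    have "(LINT z|m s. K1 x z) = (LINT z|m s. x * (z * indicator {..1} z) - (1 - exp (- (x * z))))"
      by (intro Bochner_Integration.integral_cong) (auto simp: K1_def)
    also have "\<dots> = x * \<iota> - (LINT z|m s. 1 - exp (- (x * z)))"
      using small_int exp_int[OF that] by (subst Bochner_Integration.integral_diff) (auto simp: \<iota>)
    finally show ?thesis by (simp add: phi_def c0 algebra_simps)
  qed
  define \<pi> where "\<pi> = density (m s) (\<lambda>z. ennreal (min 1 z))"
  have space_\<pi>: "space \<pi> = {0<..}" by (simp add: \<pi>_def space_m[OF s0])
  have "finite_measure \<pi>"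
  proof (rule finite_measureI)
    have "emeasure \<pi> (space \<pi>) = (\<integral>\<^sup>+z. ennreal (min 1 z) \<partial>m s)"
      unfolding \<pi>_def using min_meas by (subst emeasure_density) (auto intro!: nn_integral_cong)
    with min_nn show "emeasure \<pi> (space \<pi>) \<noteq> \<infinity>" by simp
  qed
  \<comment> \<open>Any number above the mass of \<open>\<pi>\<close> serves; adding 1 keeps it positive when \<open>\<pi>\<close> vanishes.\<close>
  define r where "r = measure \<pi> (space \<pi>) + 1"
  have r: "0 < r" "measure \<pi> (space \<pi>) \<le> r" by (auto simp: r_def add_nonneg_pos)
  define L where "L w = (LINT z|m s. 1 - exp (- (k * z * (1 - w))))" for w
  have meas: "(\<lambda>z. - (1 - exp (- (k * z * (1 - w)))) / (min 1 z * (r * k))) \<in> borel_measurable (m s)" for w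
    by (rule measurable_m[OF s0]) measurable
  have f: "is_pgf (\<lambda>w. 1 + (LINT z|\<pi>. - (1 - exp (- (k * z * (1 - w)))) / (min 1 z * (r * k))))"
  proof (rule is_pgf_perturbation_mixture[where r = r])
    fix z assume "z \<in> space \<pi>"
    then have z: "0 < z" by (simp add: space_\<pi>)
    have "1 - exp (- (k * z)) \<le> k * min 1 z"
      using exp_minus_bounds(1)[of "k * z"] z k by (auto simp: min_def intro: order_trans[of _ 1])
    then have "is_pgf (\<lambda>w. 1 - 1 / (k * min 1 z) * (1 - exp (- (k * z * (1 - w)))))"
      using z k by (intro is_pgf_one_minus_poisson) (auto simp: field_simps)
    then show "is_pgf (\<lambda>w. 1 + r * (- (1 - exp (- (k * z * (1 - w)))) / (min 1 z * (r * k))))"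
      by (rule is_pgf_cong[rotated]) (use r k z in \<open>simp add: field_simps\<close>)
  next
    show "(\<lambda>z. - (1 - exp (- (k * z * (1 - w)))) / (min 1 z * (r * k))) \<in> borel_measurable \<pi>" for w
      using meas by (simp add: \<pi>_def)
  qed (use r \<open>finite_measure \<pi>\<close> is_pgf_one in auto)
  have cancel: "\<rho> * (- E / (\<rho> * q)) = - 1 / q * E" if "\<rho> \<noteq> 0" for \<rho> E q :: real
    using that by simp
  have fL: "(LINT z|\<pi>. - (1 - exp (- (k * z * (1 - w)))) / (min 1 z * (r * k))) = - L w / (r * k)" for w
  proof -
    have "(LINT z|\<pi>. - (1 - exp (- (k * z * (1 - w)))) / (min 1 z * (r * k)))
        = (LINT z|m s. min 1 z *\<^sub>R (- (1 - exp (- (k * z * (1 - w)))) / (min 1 z * (r * k))))"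
      unfolding \<pi>_def using meas min_meas by (intro integral_density) (auto intro!: AE_I2 simp: space_m[OF s0])
    also have "\<dots> = (LINT z|m s. - 1 / (r * k) * (1 - exp (- (k * z * (1 - w)))))"
    proof (rule Bochner_Integration.integral_cong)
      fix z assume "z \<in> space (m s)"
      then have "0 < z" by (simp add: space_m[OF s0])
      then have "min 1 z \<noteq> 0" by linarith
      then show "min 1 z *\<^sub>R (- (1 - exp (- (k * z * (1 - w)))) / (min 1 z * (r * k)))
          = - 1 / (r * k) * (1 - exp (- (k * z * (1 - w))))"
        unfolding real_scaleR_def by (rule cancel)
    qed simp
    also have "\<dots> = - 1 / (r * k) * L w" unfolding L_def by (rule integral_mult_right_zero)
    finally show ?thesis by simp
  qed
  have "is_pgf (\<lambda>w. exp (- (\<Delta> * r * (1 - (1 + - L w / (r * k))))))"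
    using is_pgf_compound_poisson[OF f, of "\<Delta> * r"] \<Delta> r unfolding fL by simp
  moreover have "is_pgf (\<lambda>w. exp (- ((1 - (b1 s + \<iota>) * \<Delta>) * (1 - w))))"
    using is_pgf_compound_poisson[OF is_pgf_id] q by simp
  ultimately have "is_pgf (\<lambda>w. exp (- (\<Delta> * r * (1 - (1 + - L w / (r * k)))))
      * exp (- ((1 - (b1 s + \<iota>) * \<Delta>) * (1 - w))))"
    by (rule is_pgf_mult)
  then show ?thesis
  proof (rule is_pgf_cong[rotated])
    fix w :: real assume w: "w \<in> {0..1}"
    have "\<phi> s (k * (1 - w)) = (b1 s + \<iota>) * (k * (1 - w)) - L w"
      using phi_atom[of "k * (1 - w)"] k w by (simp add: L_def mult_ac)
    then have "atom_pgf k s w = exp (- ((k * (1 - w) - \<Delta> * ((b1 s + \<iota>) * (k * (1 - w)) - L w)) / k))"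
      by (simp add: atom_pgf_def \<Delta>_def)
    also have "(k * (1 - w) - \<Delta> * ((b1 s + \<iota>) * (k * (1 - w)) - L w)) / k
        = \<Delta> * r * (1 - (1 + - L w / (r * k))) + (1 - (b1 s + \<iota>) * \<Delta>) * (1 - w)"
      using r k by (simp add: field_simps)
    finally show "exp (- (\<Delta> * r * (1 - (1 + - L w / (r * k)))))
      * exp (- ((1 - (b1 s + \<iota>) * \<Delta>) * (1 - w))) = atom_pgf k s w"
      by (simp add: exp_add[symmetric])
  qed
qed

text \<open>With $a=\lambda-\mu(\{s\})\phi(s,\lambda)$ the error is $k(e^{-a/k}-1+a/k)$, which is at most $a^2/k$ as $a\ge0$;
  and $a\ge0$ because a generating function does not exceed 1.\<close>

lemma atom_pgf_error:
  assumes s: "0 < s" and atom: "0 < measure \<mu> {s}" and k: "1 \<le> k"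
    and \<theta>: "0 \<le> \<theta>" "\<theta> \<le> M" "\<theta> \<le> k"
  shows "\<bar>k * (atom_pgf k s (1 - \<theta> / k) - (1 - \<theta> / k)) - \<phi> s \<theta> * measure \<mu> {s}\<bar>
    \<le> (M + 2 * K * (1 + M)\<^sup>2 * measure \<mu> {s})\<^sup>2 / k"
proof -
  define \<Delta> where "\<Delta> = measure \<mu> {s}"
  define a where "a = \<theta> - \<Delta> * \<phi> s \<theta>"
  have g: "atom_pgf k s (1 - \<theta> / k) = exp (- (a / k))"
    using k by (simp add: atom_pgf_def a_def \<Delta>_def)
  have "atom_pgf k s (1 - \<theta> / k) \<in> {0..1}"
  proof (rule is_pgf_range[OF is_pgf_atom[OF s atom k]])
    show "1 - \<theta> / k \<in> {0..1}" using \<theta> k by simp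
  qed
  then have a0: "0 \<le> a / k" unfolding g by simp
  have "- \<phi> s \<theta> \<le> 2 * K * (1 + M)\<^sup>2"
    using phi_bound[of s \<theta> M] s \<theta> by linarith
  then have "\<Delta> * - \<phi> s \<theta> \<le> \<Delta> * (2 * K * (1 + M)\<^sup>2)"
    by (rule mult_left_mono) (simp add: \<Delta>_def)
  then have aM: "a \<le> M + 2 * K * (1 + M)\<^sup>2 * \<Delta>" using \<theta> by (simp add: a_def mult_ac)
  have eq: "k * (atom_pgf k s (1 - \<theta> / k) - (1 - \<theta> / k)) - \<phi> s \<theta> * \<Delta>
      = k * (exp (- (a / k)) - 1 + a / k)"
    unfolding g using k by (simp add: a_def field_simps)
  have "\<bar>k * (exp (- (a / k)) - 1 + a / k)\<bar> \<le> k * (a / k)\<^sup>2"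
    using exp_minus_bounds[OF a0] k by (simp add: abs_mult)
  also have "\<dots> = a\<^sup>2 / k" using k by (simp add: power2_eq_square)
  also have "\<dots> \<le> (M + 2 * K * (1 + M)\<^sup>2 * \<Delta>)\<^sup>2 / k"
  proof (intro divide_right_mono power_mono)
    show "0 \<le> a" using a0 k by (simp add: zero_le_divide_iff)
  qed (use aM k in auto)
  finally show ?thesis unfolding \<Delta>_def[symmetric] eq .
qed

end

section \<open>The offspring generating functions and their total error\<close>

lemma foldr_comp_id: "(\<And>f. f \<in> set fs \<Longrightarrow> f = id) \<Longrightarrow> foldr (\<circ>) fs id = id"
  by (induction fs) auto

lemma comp_range_id:
  assumes "\<And>j. m \<le> j \<Longrightarrow> j < n \<Longrightarrow> g j = id" shows "comp_range g m n = id"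
  unfolding comp_range_def using assms by (intro foldr_comp_id) auto

lemma comp_range_first:
  assumes "m < n" "\<And>j. m < j \<Longrightarrow> j < n \<Longrightarrow> g j = id" shows "comp_range g m n = g m"
proof -
  have "comp_range g m n = g m \<circ> comp_range g (Suc m) n"
    using assms(1) by (simp add: comp_range_def upt_conv_Cons)
  also have "comp_range g (Suc m) n = id" using assms(2) by (intro comp_range_id) auto
  finally show ?thesis by simp
qed

context branching_parameters begin

definition \<beta> :: "nat \<Rightarrow> real" where "\<beta> k = 12 * K * real k"

text \<open>The mass from which on an atom is treated by \<open>atom_pgf\<close>. It tends to 0 slowly enough
  that there are only $O(\sqrt k)$ such atoms, each with error $O(1/k)$.\<close>

definition \<delta> :: "nat \<Rightarrow> real" where "\<delta> k = 1 / sqrt (real k + 1)"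

abbreviation N :: "nat \<Rightarrow> real \<Rightarrow> nat" where "N k \<equiv> gamma_k \<gamma> \<beta> k"

lemma \<beta>_pos: "1 \<le> k \<Longrightarrow> 0 < \<beta> k"
  using K by (simp add: \<beta>_def)

lemma \<delta>_pos: "0 < \<delta> k"
  by (simp add: \<delta>_def)

text \<open>An atom at which $\gamma_k$ jumps by exactly 1 has mass below $2/\beta_k$, hence below the threshold.
  At such a jump there is no free index for \<open>atom_pgf\<close>.\<close>

lemma two_le_\<beta>_\<delta>:
  assumes "1 \<le> k" shows "2 / \<beta> k \<le> \<delta> k"
proof -
  have "sqrt (real k + 1) \<le> real k + 1"
    by (rule real_le_lsqrt) (auto simp: power2_eq_square algebra_simps)
  also have "\<dots> \<le> 1 * (2 * real k)" using assms by simp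
  also have "\<dots> \<le> K * (2 * real k)" using K by (intro mult_right_mono) auto
  also have "\<dots> \<le> \<beta> k / 2" using K by (simp add: \<beta>_def)
  finally show ?thesis using \<beta>_pos[OF assms] by (simp add: \<delta>_def field_simps)
qed

lemma N_bounds:
  assumes "1 \<le> k" "0 \<le> t"
  shows "real (N k t) \<le> \<beta> k * \<gamma> t" "\<beta> k * \<gamma> t < real (N k t) + 1"
proof -
  have "0 \<le> \<beta> k * \<gamma> t" using \<beta>_pos[OF assms(1)] nonneg[OF assms(2)] by simp
  then have "real (N k t) = of_int \<lfloor>\<beta> k * \<gamma> t\<rfloor>" by (simp add: gamma_k_def)
  then show "real (N k t) \<le> \<beta> k * \<gamma> t" "\<beta> k * \<gamma> t < real (N k t) + 1" by linarith+
qed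

lemma step_path_N:
  assumes k: "1 \<le> k" shows "step_path (N k)"
proof
  show mono_N: "N k s \<le> N k t" if "0 \<le> s" "s \<le> t" for s t
    unfolding gamma_k_def using mono[OF that] \<beta>_pos[OF k]
    by (intro nat_mono floor_mono mult_left_mono) auto
  fix t :: real assume t: "0 \<le> t"
  have "\<gamma> t < (real (N k t) + 1) / \<beta> k"
    using N_bounds(2)[OF k t] \<beta>_pos[OF k] by (simp add: field_simps)
  then have "eventually (\<lambda>u. \<gamma> u < (real (N k t) + 1) / \<beta> k) (at_right t)"
    using right_cont[OF t] by (rule order_tendstoD(2)[rotated])
  then have "eventually (\<lambda>u. t < u \<and> \<gamma> u < (real (N k t) + 1) / \<beta> k) (at_right t)"
    using eventually_at_right_less[of t] by eventually_elim auto
  then obtain u where u: "t < u" "\<gamma> u < (real (N k t) + 1) / \<beta> k"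
    using eventually_happens'[of "at_right t"] by auto
  then have "real (N k u) < real (N k t) + 1"
    using N_bounds(1)[OF k, of u] t \<beta>_pos[OF k] by (simp add: field_simps)
  with mono_N[OF t, of u] u(1) show "\<exists>u>t. N k u = N k t" by (intro exI[of _ u]) auto
qed

abbreviation pre :: "nat \<Rightarrow> real \<Rightarrow> nat" where "pre k s \<equiv> left_lim (N k) s"

definition jump_times :: "nat \<Rightarrow> real set" where
  "jump_times k = {s. 0 < s \<and> pre k s < N k s}"

lemma J_k_eq:
  assumes "1 \<le> k" "0 \<le> r"
  shows "J_k \<gamma> \<beta> k r t = step_path.jumps (N k) r t" "J_k \<gamma> \<beta> k r t = jump_times k \<inter> {r<..t}"
proof -
  interpret P: step_path "N k" by (rule step_path_N[OF assms(1)])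
  show *: "J_k \<gamma> \<beta> k r t = P.jumps r t"
    unfolding J_k_def by (rule P.jumps_eq[OF assms(2), symmetric])
  have "s \<in> P.jumps r t \<longleftrightarrow> s \<in> jump_times k \<inter> {r<..t}" for s
    unfolding P.jumps_def jump_times_def using assms(2) by (cases "r < s") (simp_all add: conj_commute)
  then show "J_k \<gamma> \<beta> k r t = jump_times k \<inter> {r<..t}" unfolding * by blast
qed

lemma jump_times_separated:
  assumes "1 \<le> k" "s \<in> jump_times k" "s < s'"
  shows "pre k s < N k s" "N k s \<le> pre k s'"
proof -
  interpret P: step_path "N k" by (rule step_path_N[OF assms(1)])
  show "pre k s < N k s" "N k s \<le> pre k s'"
    using assms P.le_pre[of s s'] by (auto simp: jump_times_def)
qed

lemma jump_index_unique:
  assumes "1 \<le> k" "s \<in> jump_times k" "s' \<in> jump_times k"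
    and "pre k s \<le> i" "i < N k s" "pre k s' \<le> i" "i < N k s'"
  shows "s = s'"
  using jump_times_separated[OF assms(1), of s s'] jump_times_separated[OF assms(1), of s' s] assms
  by (cases s s' rule: linorder_cases) auto

text \<open>Every index \<open>i\<close> is passed by at most one jump of $\gamma_k$, namely at the time \<open>s\<close> with
  $\gamma_k(s-)\le i<\gamma_k(s)$. The lowest index of a jump serves the interval that ends there, the next
  one the atom, and the remaining ones are filled up with the identity, which leaves the composition in
  the second part of condition (A) unchanged.\<close>

definition g :: "nat \<Rightarrow> nat \<Rightarrow> real \<Rightarrow> real" where
  "g k i =
     (if \<exists>s\<in>jump_times k. pre k s \<le> i \<and> i < N k s then
        let s = (THE s. s \<in> jump_times k \<and> pre k s \<le> i \<and> i < N k s) in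
          if i = pre k s then interval_pgf (real k) (gamma_k_inv \<gamma> \<beta> k i) s
          else if i = pre k s + 1 \<and> \<delta> k \<le> measure \<mu> {s} then atom_pgf (real k) s
          else id
      else id)"

lemma g_eq:
  assumes "1 \<le> k" "s \<in> jump_times k" "pre k s \<le> i" "i < N k s"
  shows "g k i = (if i = pre k s then interval_pgf (real k) (gamma_k_inv \<gamma> \<beta> k i) s
          else if i = pre k s + 1 \<and> \<delta> k \<le> measure \<mu> {s} then atom_pgf (real k) s
          else id)"
proof -
  have "(THE s. s \<in> jump_times k \<and> pre k s \<le> i \<and> i < N k s) = s"
  proof (rule the_equality)
    show "s \<in> jump_times k \<and> pre k s \<le> i \<and> i < N k s" using assms by simp
    fix s' assume "s' \<in> jump_times k \<and> pre k s' \<le> i \<and> i < N k s'"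
    then show "s' = s" by (intro jump_index_unique[OF assms(1) _ assms(2) _ _ assms(3,4)]) simp_all
  qed
  moreover have "\<exists>s\<in>jump_times k. pre k s \<le> i \<and> i < N k s"
    using assms(3,4) by (intro bexI[OF _ assms(2)] conjI)
  ultimately show ?thesis unfolding g_def Let_def by (simp only: if_True)
qed

text \<open>On the open interval $\gamma_k$ is constant, so $\gamma$ varies by at most $1/\beta_k$ there.\<close>

lemma level_interval:
  assumes k: "1 \<le> k" and s: "s \<in> jump_times k"
  shows "0 \<le> gamma_k_inv \<gamma> \<beta> k (pre k s)"
    and "measure \<mu> {gamma_k_inv \<gamma> \<beta> k (pre k s)<..<s} \<le> 1 / \<beta> k"
proof -
  interpret P: step_path "N k" by (rule step_path_N[OF k])
  define S where "S = {u. 0 \<le> u \<and> pre k s \<le> N k u}"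
  define a where "a = Inf S"
  have a: "gamma_k_inv \<gamma> \<beta> k (pre k s) = a" by (simp add: gamma_k_inv_def a_def S_def)
  have s0: "0 < s" using s by (simp add: jump_times_def)
  obtain u where u: "0 \<le> u" "u < s" "\<And>v. u \<le> v \<Longrightarrow> v < s \<Longrightarrow> N k v = pre k s"
    using P.left_const[OF s0] by metis
  have bdd: "bdd_below S" by (rule bdd_belowI[of _ 0]) (auto simp: S_def)
  have uS: "u \<in> S" using u by (auto simp: S_def)
  show "0 \<le> gamma_k_inv \<gamma> \<beta> k (pre k s)"
    unfolding a a_def using uS by (intro cInf_greatest) (auto simp: S_def)
  then have a0: "0 \<le> a" by (simp add: a)
  have "a \<le> u" unfolding a_def using uS bdd by (rule cInf_lower)
  with u have as: "a < s" by simp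
  have "measure \<mu> {a<..<s} \<le> (real (pre k s) + 1) / \<beta> k - real (pre k s) / \<beta> k"
  proof (rule open_interval_le[OF a0 as])
    fix v assume v: "a < v" "v < s"
    then have v0: "0 \<le> v" using a0 by simp
    obtain x where "x \<in> S" "x < v" using cInf_lessD[of S v] uS v by (auto simp: a_def)
    then have "pre k s \<le> N k v" using P.mono[of x v] by (auto simp: S_def)
    moreover have "N k v \<le> pre k s" using P.le_pre[OF v0 v(2)] .
    ultimately have "N k v = pre k s" by simp
    with N_bounds[OF k v0] show "real (pre k s) / \<beta> k \<le> \<gamma> v \<and> \<gamma> v \<le> (real (pre k s) + 1) / \<beta> k"
      using \<beta>_pos[OF k] by (simp add: field_simps)
  qed
  also have "\<dots> = 1 / \<beta> k" by (simp add: add_divide_distrib)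
  finally show "measure \<mu> {gamma_k_inv \<gamma> \<beta> k (pre k s)<..<s} \<le> 1 / \<beta> k" by (simp add: a)
qed

lemma small_atom_of_unit_jump:
  assumes k: "1 \<le> k" and s: "s \<in> jump_times k" and "N k s = pre k s + 1"
  shows "measure \<mu> {s} < \<delta> k"
proof -
  interpret P: step_path "N k" by (rule step_path_N[OF k])
  have s0: "0 < s" using s by (simp add: jump_times_def)
  obtain u where u: "0 \<le> u" "u < s" "N k u = pre k s"
    using P.left_const[OF s0] by (metis order_refl)
  have "\<beta> k * (\<gamma> s - \<gamma> u) < 2"
    using N_bounds(2)[OF k, of s] N_bounds(1)[OF k u(1)] s0 u(3) assms(3)
    by (simp add: algebra_simps)
  then have "\<gamma> s - \<gamma> u < 2 / \<beta> k" using \<beta>_pos[OF k] by (simp add: field_simps)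
  with atom_le[OF u(1,2)] two_le_\<beta>_\<delta>[OF k] show ?thesis by linarith
qed

lemma is_pgf_g:
  assumes k: "1 \<le> k" shows "is_pgf (g k i)"
proof (cases "\<exists>s\<in>jump_times k. pre k s \<le> i \<and> i < N k s")
  case True
  then obtain s where s: "s \<in> jump_times k" "pre k s \<le> i" "i < N k s" by auto
  have s0: "0 < s" using s by (simp add: jump_times_def)
  have "is_pgf (interval_pgf (real k) (gamma_k_inv \<gamma> \<beta> k (pre k s)) s)"
    using level_interval[OF k s(1)] k by (intro is_pgf_interval[where \<beta> = "\<beta> k"]) (auto simp: \<beta>_def)
  moreover have "is_pgf (atom_pgf (real k) s)" if "\<delta> k \<le> measure \<mu> {s}"
    using s0 less_le_trans[OF \<delta>_pos that] k by (intro is_pgf_atom) auto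
  ultimately show ?thesis
    using g_eq[OF k s] is_pgf_id by (auto simp: id_def)
next
  case False
  then have "g k i = id" unfolding g_def by auto
  then show ?thesis using is_pgf_id by (simp add: id_def)
qed

definition jump_error :: "real \<Rightarrow> nat \<Rightarrow> real \<Rightarrow> real" where
  "jump_error M k s = 2 * K * M\<^sup>2 / (real k * \<beta> k) +
     (if measure \<mu> {s} < \<delta> k then 2 * K * (1 + M)\<^sup>2 * measure \<mu> {s}
      else (M + 2 * K * (1 + M)\<^sup>2 * measure \<mu> {s})\<^sup>2 / real k)"

lemma jump_error_nonneg: "1 \<le> k \<Longrightarrow> 0 \<le> jump_error M k s"
  using K \<beta>_pos[of k] by (auto simp: jump_error_def)

lemma I_ks_le_jump_error:
  assumes k: "1 \<le> k" and s: "s \<in> jump_times k" and \<theta>: "0 \<le> \<theta>" "\<theta> \<le> M" and M: "M \<le> real k"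
  shows "I_ks \<gamma> \<phi> \<beta> g k s \<theta> \<le> jump_error M k s"
proof -
  have s0: "0 < s" and lt: "pre k s < N k s" using s by (auto simp: jump_times_def)
  have k1: "1 \<le> real k" using k by simp
  have "\<bar>I_ks1 \<gamma> \<phi> \<beta> g k s \<theta>\<bar> \<le> 2 * K * M\<^sup>2 / (real k * \<beta> k)"
    unfolding I_ks1_def Let_def g_eq[OF k s order_refl lt]
    using interval_pgf_error[OF level_interval(1)[OF k s] k1 level_interval(2)[OF k s] \<beta>_pos[OF k] \<theta>]
    by simp
  moreover have "\<bar>I_ks2 \<gamma> \<phi> \<beta> g k s \<theta>\<bar> \<le> (if measure \<mu> {s} < \<delta> k then 2 * K * (1 + M)\<^sup>2 * measure \<mu> {s}
      else (M + 2 * K * (1 + M)\<^sup>2 * measure \<mu> {s})\<^sup>2 / real k)"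
  proof (cases "measure \<mu> {s} < \<delta> k")
    case True
    have "comp_range (g k) (pre k s + 1) (N k s) = id"
      using g_eq[OF k s] True by (intro comp_range_id) auto
    then have "\<bar>I_ks2 \<gamma> \<phi> \<beta> g k s \<theta>\<bar> = \<bar>\<phi> s \<theta>\<bar> * measure \<mu> {s}"
      by (simp add: I_ks2_def abs_mult)
    also have "\<dots> \<le> 2 * K * (1 + M)\<^sup>2 * measure \<mu> {s}"
      using phi_bound[of s \<theta> M] s0 \<theta> by (intro mult_right_mono) auto
    finally show ?thesis using True by simp
  next
    case False
    then have "N k s \<noteq> pre k s + 1" using small_atom_of_unit_jump[OF k s] by auto
    with lt have lt2: "pre k s + 1 < N k s" by simp
    have "comp_range (g k) (pre k s + 1) (N k s) = g k (pre k s + 1)"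
      using g_eq[OF k s] by (intro comp_range_first lt2) auto
    also have "\<dots> = atom_pgf (real k) s"
      using g_eq[OF k s, of "pre k s + 1"] lt2 False by auto
    finally have c: "comp_range (g k) (pre k s + 1) (N k s) = atom_pgf (real k) s" .
    have "0 < measure \<mu> {s}" using False \<delta>_pos[of k] by linarith
    from atom_pgf_error[OF s0 this k1 \<theta>] \<theta> M False show ?thesis
      unfolding I_ks2_def c by simp
  qed
  ultimately show ?thesis by (simp add: I_ks_def jump_error_def)
qed

definition F :: "real \<Rightarrow> nat \<Rightarrow> real \<Rightarrow> real" where
  "F M k t = sum (jump_error M k) (J_k \<gamma> \<beta> k 0 t)"

text \<open>The three terms come from the intervals, of which there are at most $\beta_k\gamma(t)$; from the atoms below
  the threshold; and from the atoms above it, of which there are at most $\gamma(t)\sqrt{k+1}$.\<close>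

lemma F_bound:
  assumes k: "1 \<le> k" and t: "0 \<le> t" and M: "0 \<le> M"
  shows "F M k t \<le> 2 * K * M\<^sup>2 * \<gamma> t / real k
    + 2 * K * (1 + M)\<^sup>2 * measure \<mu> {s \<in> {0<..t}. 0 < measure \<mu> {s} \<and> measure \<mu> {s} < \<delta> k}
    + \<gamma> t * (M + 2 * K * (1 + M)\<^sup>2 * \<gamma> t)\<^sup>2 * (sqrt (real k + 1) / real k)"
proof -
  interpret P: step_path "N k" by (rule step_path_N[OF k])
  define J where "J = J_k \<gamma> \<beta> k 0 t"
  define C where "C = 2 * K * (1 + M)\<^sup>2"
  have C0: "0 \<le> C" using K by (simp add: C_def)
  have J: "J = P.jumps 0 t" unfolding J_def by (rule J_k_eq[OF k order_refl])
  have fin: "finite J" unfolding J by (rule P.finite_jumps) simp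
  have sub: "J \<subseteq> {0<..t}" unfolding J P.jumps_def by auto
  have k0: "0 < real k" using k by simp
  define Js where "Js = J \<inter> {s. measure \<mu> {s} < \<delta> k}"
  define Jl where "Jl = J \<inter> - {s. measure \<mu> {s} < \<delta> k}"
  have "F M k t = (\<Sum>s\<in>J. 2 * K * M\<^sup>2 / (real k * \<beta> k)) + (\<Sum>s\<in>J. if measure \<mu> {s} < \<delta> k
      then C * measure \<mu> {s} else (M + C * measure \<mu> {s})\<^sup>2 / real k)"
    unfolding F_def jump_error_def C_def J_def by (rule sum.distrib)
  also have "(\<Sum>s\<in>J. if measure \<mu> {s} < \<delta> k then C * measure \<mu> {s} else (M + C * measure \<mu> {s})\<^sup>2 / real k)
      = C * (\<Sum>s\<in>Js. measure \<mu> {s}) + (\<Sum>s\<in>Jl. (M + C * measure \<mu> {s})\<^sup>2 / real k)"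
    unfolding Js_def Jl_def sum_distrib_left by (rule sum.If_cases[OF fin])
  finally have split: "F M k t = (\<Sum>s\<in>J. 2 * K * M\<^sup>2 / (real k * \<beta> k))
      + (C * (\<Sum>s\<in>Js. measure \<mu> {s}) + (\<Sum>s\<in>Jl. (M + C * measure \<mu> {s})\<^sup>2 / real k))" .
  have 1: "(\<Sum>s\<in>J. 2 * K * M\<^sup>2 / (real k * \<beta> k)) \<le> 2 * K * M\<^sup>2 * \<gamma> t / real k"
  proof -
    have "real (card J) \<le> \<beta> k * \<gamma> t"
      using P.card_jumps[of t] N_bounds(1)[OF k t] unfolding J by linarith
    then have "real (card J) * (2 * K * M\<^sup>2 / (real k * \<beta> k)) \<le> \<beta> k * \<gamma> t * (2 * K * M\<^sup>2 / (real k * \<beta> k))"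
      using K \<beta>_pos[OF k] by (intro mult_right_mono) auto
    then show ?thesis using \<beta>_pos[OF k] k0 by (simp add: field_simps)
  qed
  have 2: "(\<Sum>s\<in>Js. measure \<mu> {s}) \<le> measure \<mu> {s \<in> {0<..t}. 0 < measure \<mu> {s} \<and> measure \<mu> {s} < \<delta> k}"
  proof -
    define A where "A = {s \<in> Js. 0 < measure \<mu> {s}}"
    have A: "finite A" "A \<subseteq> {0<..t}" using fin sub by (auto simp: A_def Js_def)
    have "(\<Sum>s\<in>Js. measure \<mu> {s}) = (\<Sum>s\<in>A. measure \<mu> {s})"
    proof (rule sum.mono_neutral_right)
      show "finite Js" using fin by (simp add: Js_def)
      show "\<forall>s\<in>Js - A. measure \<mu> {s} = 0" using zero_less_measure_iff[of \<mu>] by (simp add: A_def)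
    qed (simp add: A_def)
    also have "\<dots> = measure \<mu> A" by (rule atoms_sum[OF A])
    also have "\<dots> \<le> measure \<mu> {s \<in> {0<..t}. 0 < measure \<mu> {s} \<and> measure \<mu> {s} < \<delta> k}"
    proof (rule measure_mono')
      show "A \<subseteq> {s \<in> {0<..t}. 0 < measure \<mu> {s} \<and> measure \<mu> {s} < \<delta> k}"
        using A(2) unfolding A_def Js_def by blast
      show "A \<in> sets borel" using finite_imp_closed[OF A(1)] by (rule borel_closed)
      show "{s \<in> {0<..t}. 0 < measure \<mu> {s} \<and> measure \<mu> {s} < \<delta> k} \<in> sets borel"
        using small_atoms_sets by simp
    qed blast
    finally show ?thesis .
  qed
  have 3: "(\<Sum>s\<in>Jl. (M + C * measure \<mu> {s})\<^sup>2 / real k)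
      \<le> \<gamma> t * (M + C * \<gamma> t)\<^sup>2 * (sqrt (real k + 1) / real k)"
  proof -
    have Jl: "finite Jl" "Jl \<subseteq> {0<..t}" using fin sub by (auto simp: Jl_def)
    have "(\<Sum>s\<in>Jl. (M + C * measure \<mu> {s})\<^sup>2 / real k) \<le> (\<Sum>s\<in>Jl. (M + C * \<gamma> t)\<^sup>2 / real k)"
    proof (rule sum_mono)
      fix s assume "s \<in> Jl"
      then have "measure \<mu> {s} \<le> \<gamma> t" using atoms_sum_le[of "{s}" t] Jl t by auto
      then show "(M + C * measure \<mu> {s})\<^sup>2 / real k \<le> (M + C * \<gamma> t)\<^sup>2 / real k"
        using C0 M k0 by (intro divide_right_mono power_mono add_left_mono mult_left_mono) auto
    qed
    also have "\<dots> = real (card Jl) * ((M + C * \<gamma> t)\<^sup>2 / real k)" by simp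
    also have "\<dots> \<le> (\<gamma> t * sqrt (real k + 1)) * ((M + C * \<gamma> t)\<^sup>2 / real k)"
    proof (rule mult_right_mono)
      have "real (card Jl) * \<delta> k \<le> (\<Sum>s\<in>Jl. measure \<mu> {s})"
        by (rule sum_bounded_below) (auto simp: Jl_def)
      also have "\<dots> \<le> \<gamma> t" by (rule atoms_sum_le[OF Jl t])
      finally show "real (card Jl) \<le> \<gamma> t * sqrt (real k + 1)"
        by (simp add: \<delta>_def field_simps)
    qed (use k0 in simp)
    finally show ?thesis by (simp add: mult_ac)
  qed
  show ?thesis
    unfolding split C_def[symmetric] using 1 3 mult_left_mono[OF 2 C0] by linarith
qed

lemma F_tendsto_0:
  assumes t: "0 \<le> t" and M: "0 \<le> M"
  shows "(\<lambda>k. F M k t) \<longlonglongrightarrow> 0"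
proof (rule tendsto_sandwich)
  show "eventually (\<lambda>k. 0 \<le> F M k t) sequentially"
    using eventually_ge_at_top[of 1]
    by eventually_elim (auto simp: F_def intro!: sum_nonneg jump_error_nonneg)
  show "eventually (\<lambda>k. F M k t \<le> 2 * K * M\<^sup>2 * \<gamma> t / real k
    + 2 * K * (1 + M)\<^sup>2 * measure \<mu> {s \<in> {0<..t}. 0 < measure \<mu> {s} \<and> measure \<mu> {s} < \<delta> k}
    + \<gamma> t * (M + 2 * K * (1 + M)\<^sup>2 * \<gamma> t)\<^sup>2 * (sqrt (real k + 1) / real k)) sequentially"
    using eventually_ge_at_top[of 1] by eventually_elim (rule F_bound[OF _ t M])
  have 1: "(\<lambda>k. 2 * K * M\<^sup>2 * \<gamma> t / real k) \<longlonglongrightarrow> 0"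
    by (rule lim_const_over_n)
  have "\<delta> \<longlonglongrightarrow> 0" unfolding \<delta>_def by real_asymp
  moreover have "decseq \<delta>" unfolding decseq_def \<delta>_def by (auto intro!: divide_left_mono)
  ultimately have 2: "(\<lambda>k. measure \<mu> {s \<in> {0<..t}. 0 < measure \<mu> {s} \<and> measure \<mu> {s} < \<delta> k}) \<longlonglongrightarrow> 0"
    by (rule small_atoms_vanish)
  have 3: "(\<lambda>k. sqrt (real k + 1) / real k) \<longlonglongrightarrow> 0" by real_asymp
  show "(\<lambda>k. 2 * K * M\<^sup>2 * \<gamma> t / real k
    + 2 * K * (1 + M)\<^sup>2 * measure \<mu> {s \<in> {0<..t}. 0 < measure \<mu> {s} \<and> measure \<mu> {s} < \<delta> k}
    + \<gamma> t * (M + 2 * K * (1 + M)\<^sup>2 * \<gamma> t)\<^sup>2 * (sqrt (real k + 1) / real k)) \<longlonglongrightarrow> 0"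
    using tendsto_add[OF tendsto_add[OF 1 tendsto_mult_right_zero[OF 2]] tendsto_mult_right_zero[OF 3]]
    by simp
qed auto

lemma condition_A_g: "condition_A \<gamma> \<phi> \<beta> g"
  unfolding condition_A_def
proof (intro allI impI)
  fix M :: real assume M: "0 < M"
  have incr: "F M k t - F M k r = sum (jump_error M k) (J_k \<gamma> \<beta> k r t)" if "1 \<le> k" "0 \<le> r" "r \<le> t" for k r t
  proof -
    interpret P: step_path "N k" by (rule step_path_N[OF that(1)])
    show ?thesis
      using P.sum_jumps_split[OF that(2,3)] that by (simp add: F_def J_k_eq(1))
  qed
  show "\<exists>F. (\<forall>k\<ge>1. (\<forall>s\<ge>0. 0 \<le> F k s) \<and> cadlag (F k) \<and> mono_on {0..} (F k)) \<and>
      (\<forall>s\<ge>0. (\<lambda>k. F k s) \<longlonglongrightarrow> 0) \<and>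
      (\<forall>T\<ge>0. \<forall>lam. (\<forall>k\<ge>1. \<forall>s\<in>{0..T}. lam k s \<in> {0..M}) \<longrightarrow>
         (\<forall>r t k. 0 \<le> r \<longrightarrow> r \<le> t \<longrightarrow> t \<le> T \<longrightarrow> 1 \<le> k \<longrightarrow> M \<le> real k \<longrightarrow>
            (\<Sum>s\<in>J_k \<gamma> \<beta> k r t. I_ks \<gamma> \<phi> \<beta> g k s (lam k s)) \<le> F k t - F k r))"
  proof (intro exI[of _ "F M"] conjI allI impI)
    fix k :: nat assume k: "1 \<le> k"
    show "0 \<le> F M k s" for s unfolding F_def by (intro sum_nonneg jump_error_nonneg k)
    show "cadlag (F M k)"
      using step_path.cadlag_sum_jumps[OF step_path_N[OF k], of "jump_error M k"] k
      by (simp add: F_def[abs_def] J_k_eq(1))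
    show "mono_on {0..} (F M k)"
    proof (rule mono_onI)
      fix r t :: real assume "r \<in> {0..}" "t \<in> {0..}" "r \<le> t"
      then have "0 \<le> F M k t - F M k r"
        using incr[OF k, of r t] jump_error_nonneg[OF k] by (auto intro: sum_nonneg)
      then show "F M k r \<le> F M k t" by simp
    qed
  next
    show "(\<lambda>k. F M k s) \<longlonglongrightarrow> 0" if "0 \<le> s" for s using F_tendsto_0[OF that] M by simp
  next
    fix T :: real and lam :: "nat \<Rightarrow> real \<Rightarrow> real" and r t :: real and k :: nat
    assume lam: "\<forall>k\<ge>1. \<forall>s\<in>{0..T}. lam k s \<in> {0..M}" and rt: "0 \<le> r" "r \<le> t" "t \<le> T"
      and k: "1 \<le> k" "M \<le> real k"
    have "(\<Sum>s\<in>J_k \<gamma> \<beta> k r t. I_ks \<gamma> \<phi> \<beta> g k s (lam k s)) \<le> sum (jump_error M k) (J_k \<gamma> \<beta> k r t)"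
    proof (rule sum_mono)
      fix s assume "s \<in> J_k \<gamma> \<beta> k r t"
      then have s: "s \<in> jump_times k" "r < s" "s \<le> t" using J_k_eq(2)[OF k(1) rt(1)] by auto
      then have "lam k s \<in> {0..M}" using lam k rt by auto
      then show "I_ks \<gamma> \<phi> \<beta> g k s (lam k s) \<le> jump_error M k s"
        using k s by (intro I_ks_le_jump_error) auto
    qed
    with incr[OF k(1) rt(1,2)] show "(\<Sum>s\<in>J_k \<gamma> \<beta> k r t. I_ks \<gamma> \<phi> \<beta> g k s (lam k s)) \<le> F M k t - F M k r"
      by simp
  qed
qed

lemma mono_\<beta>: "mono_on {1..} \<beta>"
  using K by (auto simp: \<beta>_def intro!: mono_onI mult_left_mono)

lemma filterlim_\<beta>: "filterlim \<beta> at_top sequentially"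
  unfolding \<beta>_def using K
  by (intro filterlim_tendsto_pos_mult_at_top[OF tendsto_const] filterlim_real_sequentially) auto

end

lemma admissible_branching_parameters:
  assumes "admissible \<gamma> b1 c m"
  obtains K where "branching_parameters \<gamma> b1 c m K"
proof -
  let ?\<kappa> = "\<lambda>s. density (m s) (\<lambda>z. ennreal (min 1 (z\<^sup>2)))"
  have A: "mono_on {0..} \<gamma>" "cadlag \<gamma>" "\<gamma> 0 = 0"
    "b1 \<in> borel_measurable (restrict_space borel {0..})" "bounded (b1 ` {0..})"
    "c \<in> borel_measurable (restrict_space borel {0..})" "bounded (c ` {0..})"
    "\<And>s. 0 \<le> s \<Longrightarrow> sets (m s) = sets (restrict_space borel {0<..})"
    "bounded_kernel (restrict_space borel {0..}) (restrict_space borel {0<..}) ?\<kappa>"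
    "\<And>s. 0 \<le> s \<Longrightarrow> 0 \<le> c s"
    "\<And>s. 0 < s \<Longrightarrow> c s * measure (induced_measure \<gamma>) {s} = 0"
    "\<And>s. 0 < s \<Longrightarrow> (ereal (b1 s) + enn2ereal (\<integral>\<^sup>+z\<in>{0<..1}. ennreal z \<partial>m s))
              * ereal (measure (induced_measure \<gamma>) {s}) \<le> 1"
    using assms unfolding admissible_def by blast+
  obtain B where "\<forall>x\<in>b1 ` {0..}. norm x \<le> B" using A(5) unfolding bounded_iff by blast
  then have B: "\<bar>b1 s\<bar> \<le> B" if "0 \<le> s" for s using that by simp
  obtain C where "\<forall>x\<in>c ` {0..}. norm x \<le> C" using A(7) unfolding bounded_iff by blast
  then have C: "\<bar>c s\<bar> \<le> C" if "0 \<le> s" for s using that by simp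
  obtain D where "\<forall>s\<in>space (restrict_space borel {0..}).
      emeasure (?\<kappa> s) (space (restrict_space borel {0<..})) \<le> ennreal D"
    using A(9) unfolding bounded_kernel_def by blast
  then have D: "emeasure (?\<kappa> s) {0<..} \<le> ennreal D" if "0 \<le> s" for s
    using that by (simp add: space_restrict_space)
  define K where "K = Max {1, B, C, D}"
  have K: "1 \<le> K" "B \<le> K" "C \<le> K" "D \<le> K" by (auto simp: K_def)
  have "branching_parameters \<gamma> b1 c m K"
  proof
    show "\<gamma> s \<le> \<gamma> t" if "0 \<le> s" "s \<le> t" for s t
      using mono_onD[OF A(1), of s t] that by simp
    show "(\<gamma> \<longlongrightarrow> \<gamma> t) (at_right t)" if "0 \<le> t" for t using A(2) that by (simp add: cadlag_def)
    show "\<bar>b1 s\<bar> \<le> K" if "0 \<le> s" for s using B[OF that] K by simp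
    show "0 \<le> c s \<and> c s \<le> K" if "0 \<le> s" for s using C[OF that] K A(10)[OF that] by simp
    show "(\<lambda>s. emeasure (?\<kappa> s) E) \<in> borel_measurable (restrict_space borel {0..})"
      if "E \<in> sets (restrict_space borel {0<..})" for E
      using A(9) that unfolding bounded_kernel_def by blast
    show "emeasure (density (m s) (\<lambda>z. ennreal (min 1 (z\<^sup>2)))) {0<..} \<le> ennreal K" if "0 \<le> s" for s
      using D[OF that] K by (meson ennreal_leI order_trans)
  qed (fact A K(1))+
  then show ?thesis by (rule that)
qed

theorem proposition3p1:
  fixes \<gamma> b1 c :: "real \<Rightarrow> real" and m :: "real \<Rightarrow> real measure"
  assumes "admissible \<gamma> b1 c m"
  shows "\<exists>(\<beta> :: nat \<Rightarrow> real) (g :: nat \<Rightarrow> nat \<Rightarrow> real \<Rightarrow> real).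
           (\<forall>k\<ge>1. 0 < \<beta> k) \<and> mono_on {1..} \<beta> \<and> filterlim \<beta> at_top sequentially \<and>
           (\<forall>k\<ge>1. \<forall>i. is_pgf (g k i)) \<and>
           condition_A \<gamma> (phi b1 c m) \<beta> g"
proof -
  obtain K where "branching_parameters \<gamma> b1 c m K"
    using admissible_branching_parameters[OF assms] .
  then interpret branching_parameters \<gamma> b1 c m K .
  show ?thesis
    using \<beta>_pos mono_\<beta> filterlim_\<beta> is_pgf_g condition_A_g by blast
qed

end
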